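(* Let $\Lambda\subset\mathbb{D}$ be discrete, $f:\mathbb{D}\setminus\Lambda\to\mathbb{C}$, and $\kappa\ge0$ an integer. Then: (1) If $\mathbf{k}_{2\kappa}(f)=\mathbf{k}_{2\kappa+3}(f)=\kappa$, then $f\in\mathcal{S}_\kappa$. (2) If $f\in\mathcal{S}_\kappa$, then $\mathbf{k}_{2\kappa}(f)=\kappa$.
   Context: $\mathbb{D}$ is the open unit disk; a set $\Lambda\subset\mathbb{D}$ is discrete if it is at most countable with accumulation points only on the unit circle. Pick matrix: $P_n(f;z_1,\dots,z_n)=\left[\frac{1-f(z_i)\overline{f(z_j)}}{1-z_i\overline{z_j}}\right]_{i,j=1}^n$ for distinct $z_i\in\mathrm{Dom}(f)$. $\mathrm{sq}_-P$ = number of negative eigenvalues (with multiplicity) of a Hermitian $P$. $\mathbf{k}_n(f)=\max\mathrm{sq}_-P_n(f;z_1,\dots,z_n)$ over distinct $z_1,\dots,z_n\in\mathrm{Dom}(f)$, and $\mathbf{k}_0(f)=0$. $\mathcal{S}_\kappa$: functions defined on $\mathbb{D}\setminus\Lambda$ for some discrete $\Lambda$ all of whose Pick matrices have at most $\kappa$ negative eigenvalues, with at least one Pick matrix having exactly $\kappa$. *)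

theory Defs
  imports Complex_Main "HOL-Analysis.Elementary_Topology" "Jordan_Normal_Form.Char_Poly" "HOL-Library.Countable_Set"
begin

definition unit_disk :: "complex set" where
  "unit_disk = {z. norm z < 1}"

definition discrete_in_disk :: "complex set \<Rightarrow> bool" where
  "discrete_in_disk L \<longleftrightarrow> L \<subseteq> unit_disk \<and> countable L \<and>
     (\<forall>z\<in>unit_disk. \<not> z islimpt L)"

definition pick_matrix :: "(complex \<Rightarrow> complex) \<Rightarrow> complex list \<Rightarrow> complex mat" where
  "pick_matrix f zs = mat (length zs) (length zs)
     (\<lambda>(i,j). (1 - f (zs!i) * cnj (f (zs!j))) / (1 - zs!i * cnj (zs!j)))"

definition sq_minus :: "complex mat \<Rightarrow> nat" where
  "sq_minus P = size (filter_mset (\<lambda>x. Im x = 0 \<and> Re x < 0) (proots (char_poly P)))"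

definition k_num :: "complex set \<Rightarrow> (complex \<Rightarrow> complex) \<Rightarrow> nat \<Rightarrow> nat" where
  "k_num D f n = (if n = 0 then 0 else
     Max {sq_minus (pick_matrix f zs) | zs. length zs = n \<and> distinct zs \<and> set zs \<subseteq> D})"

definition in_S :: "nat \<Rightarrow> complex set \<Rightarrow> (complex \<Rightarrow> complex) \<Rightarrow> bool" where
  "in_S \<kappa> D f \<longleftrightarrow> (\<exists>L. discrete_in_disk L \<and> D = unit_disk - L) \<and>
     (\<forall>zs. distinct zs \<and> set zs \<subseteq> D \<longrightarrow> sq_minus (pick_matrix f zs) \<le> \<kappa>) \<and>
     (\<exists>zs. distinct zs \<and> set zs \<subseteq> D \<and> sq_minus (pick_matrix f zs) = \<kappa>)"

end

theory Submission
  imports Defs "HOL-Complex_Analysis.Complex_Analysis" "Jordan_Normal_Form.Schur_Decomposition"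
begin

text \<open>
  Choose points \<open>B\<close> whose Pick matrix is invertible and has \<open>k\<close> negative eigenvalues. Adding points to \<open>B\<close>
  creates no further negative eigenvalue exactly when the Schur complement of the Pick kernel with respect to
  \<open>B\<close> is positive. That Schur complement has the form
  \<open>(a(z) cnj (a(w)) - b(z) cnj (b(w))) / (1 - z cnj w)\<close>, where \<open>(a, b)\<close> is the image of \<open>(1, f)\<close> under a rational
  matrix whose determinant has discrete zeros, so up to the weight \<open>a\<close> it is the Pick kernel of \<open>g = b / a\<close>.

  For (1), positivity on three additional points makes \<open>g\<close> complex differentiable (Hindmarsh: the first step of
  the Schur algorithm at \<open>p\<close> turns \<open>g\<close> into a function that is Lipschitz near \<open>p\<close>, and its limit at \<open>p\<close> yields
  the derivative). Hence \<open>g\<close> extends to a Schur function, whose Pick matrices of all orders are positive.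

  For (2), the same argument shows that \<open>f\<close> is holomorphic off a discrete set. Then \<open>g\<close> is holomorphic off a
  discrete set from the start, and positivity on two additional points, which makes \<open>g\<close> continuous, already
  suffices. So as long as fewer than \<open>\<kappa>\<close> negative eigenvalues have been found, two more points
  produce one more, and \<open>2 \<kappa>\<close> points produce all of them.
\<close>

section \<open>The spectral theorem for Hermitian matrices\<close>

text \<open>The obstacle is that \<open>f\<close> is arbitrary: all regularity has to come from
  positivity on finitely many points. Negative eigenvalues are therefore counted as the largest
  dimension of a negative definite subspace of a kernel on a finite set, a number that is monotone
  in the set.

  Positivity also controls the exceptional set. The weight \<open>a\<close> involves
  \<open>f\<close>, so nothing bounds its zeros a priori; but positivity at a single zero of
  \<open>a\<close> forces \<open>b\<close> to vanish there too, and then the determinant vanishes.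
  This makes the zeros of \<open>a\<close> sparse.

  In (2), holomorphy off a sparse set does not suffice by itself: that set may meet the domain, and
  there \<open>f\<close> can take values that no analytic continuation predicts. Continuity, which
  two points give, excludes such a jump for \<open>g\<close>. In (1) no holomorphy is available yet,
  hence the third point: 2 \<kappa> + 3 counts at most 2 \<kappa> points of \<open>B\<close> and
  three for Hindmarsh's criterion.

  The rational matrix is normalised to be the identity at 1, a point of the unit circle and so never
  in \<open>B\<close>; this is why its determinant cannot vanish identically.\<close>

definition adjoint_mat :: "complex mat \<Rightarrow> complex mat" where
  "adjoint_mat A = Matrix.mat (dim_col A) (dim_row A) (\<lambda>(i,j). cnj (A $$ (j,i)))"

lemma adjoint_mat_carrier [simp]: "A \<in> carrier_mat m n \<Longrightarrow> adjoint_mat A \<in> carrier_mat n m"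
  by (auto simp: adjoint_mat_def)

lemma adjoint_mat_index [simp]:
  "A \<in> carrier_mat m n \<Longrightarrow> i < n \<Longrightarrow> j < m \<Longrightarrow> adjoint_mat A $$ (i,j) = cnj (A $$ (j,i))"
  by (auto simp: adjoint_mat_def)

lemma index_mult_mat_sum:
  assumes "A \<in> carrier_mat m n" "B \<in> carrier_mat n p" "i < m" "j < p"
  shows "(A * B) $$ (i,j) = (\<Sum>k<n. A $$ (i,k) * B $$ (k,j))"
  using assms by (auto simp: scalar_prod_def lessThan_atLeast0 intro!: sum.cong)

lemma adjoint_mat_mult:
  assumes A: "A \<in> carrier_mat m n" and B: "B \<in> carrier_mat n p"
  shows "adjoint_mat (A * B) = adjoint_mat B * adjoint_mat A"
proof (rule eq_matI)
  fix i j assume "i < dim_row (adjoint_mat B * adjoint_mat A)" "j < dim_col (adjoint_mat B * adjoint_mat A)"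
  then have ij: "i < p" "j < m"
    using A B by (auto simp: adjoint_mat_def)
  have "adjoint_mat (A * B) $$ (i,j) = cnj ((A * B) $$ (j,i))"
    using A B ij by (intro adjoint_mat_index[of _ m p]) auto
  also have "\<dots> = (\<Sum>k<n. cnj (A $$ (j,k)) * cnj (B $$ (k,i)))"
    using index_mult_mat_sum[OF A B ij(2,1)] by simp
  also have "\<dots> = (\<Sum>k<n. adjoint_mat B $$ (i,k) * adjoint_mat A $$ (k,j))"
    using adjoint_mat_index[OF A] adjoint_mat_index[OF B] ij by (intro sum.cong) auto
  also have "\<dots> = (adjoint_mat B * adjoint_mat A) $$ (i,j)"
    using index_mult_mat_sum[OF adjoint_mat_carrier[OF B] adjoint_mat_carrier[OF A] ij] by simp
  finally show "adjoint_mat (A * B) $$ (i,j) = (adjoint_mat B * adjoint_mat A) $$ (i,j)" .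
qed (use A B in \<open>auto simp: adjoint_mat_def\<close>)

lemma cscalar_prod_sum:
  assumes "v \<in> carrier_vec n" "w \<in> carrier_vec n"
  shows "v \<bullet>c w = (\<Sum>k<n. vec_index v k * cnj (vec_index w k))"
  using assms by (auto simp: scalar_prod_def lessThan_atLeast0 conjugate_complex_def intro!: sum.cong)

text \<open>Gram-Schmidt on a basis that starts with \<open>v\<close> keeps \<open>v\<close> at its
  head but yields vectors that are merely orthogonal, so column \<open>j\<close> is divided by the
  square root of its squared norm \<open>N j\<close>.\<close>

lemma unitary_with_first_column:
  fixes v :: "complex Matrix.vec"
  assumes v: "v \<in> carrier_vec n" and v0: "v \<noteq> 0\<^sub>v n"
  obtains W c where "W \<in> carrier_mat n n" "adjoint_mat W * W = 1\<^sub>m n"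
    "\<And>i. i < n \<Longrightarrow> W $$ (i,0) = c * vec_index v i"
proof -
  interpret cof_vec_space n "TYPE(complex)" .
  have n0: "n \<noteq> 0" using v v0 by (metis eq_vecI carrier_vecD index_zero_vec(2) not_less0)
  define b where "b = basis_completion v"
  from basis_completion[OF v v0, folded b_def]
  have dist_b: "distinct b" and indep: "\<not> lin_dep (set b)" and b: "set b \<subseteq> carrier_vec n"
    and hdb: "hd b = v" and len_b: "length b = n" by auto
  from hdb len_b n0 obtain vs where bv: "b = v # vs" by (cases b) auto
  define ws where "ws = gram_schmidt n b"
  from gram_schmidt_result[OF b dist_b indep refl, folded ws_def]
  have ws: "set ws \<subseteq> carrier_vec n" "corthogonal ws" "length ws = n" by (auto simp: len_b)
  from gram_schmidt_hd[OF v, of vs, folded bv] have hdws: "hd ws = v" unfolding ws_def .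
  define N where "N j = (\<Sum>k<n. (cmod (vec_index (ws!j) k))^2)" for j
  have wsc: "ws ! j \<in> carrier_vec n" if "j < n" for j using that ws by auto
  have NN: "ws ! j \<bullet>c ws ! j = of_real (N j)" if "j < n" for j
    unfolding cscalar_prod_sum[OF wsc[OF that] wsc[OF that]] N_def
    by (simp add: complex_norm_square del: of_real_power)
  have Npos: "N j > 0" if "j < n" for j
  proof -
    have "N j \<noteq> 0" using corthogonalD[OF ws(2), of j j] NN[OF that] that ws(3) by auto
    moreover have "N j \<ge> 0" unfolding N_def by (intro sum_nonneg) auto
    ultimately show ?thesis by simp
  qed
  define W where "W = Matrix.mat n n (\<lambda>(i,j). vec_index (ws!j) i / of_real (sqrt (N j)))"
  have W: "W \<in> carrier_mat n n" by (simp add: W_def)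
  have "adjoint_mat W * W = 1\<^sub>m n"
  proof (rule eq_matI)
    fix i j assume "i < dim_row (1\<^sub>m n :: complex mat)" "j < dim_col (1\<^sub>m n :: complex mat)"
    then have ij: "i < n" "j < n" by auto
    have "(adjoint_mat W * W) $$ (i,j) = (\<Sum>k<n. adjoint_mat W $$ (i,k) * W $$ (k,j))"
      by (rule index_mult_mat_sum[OF adjoint_mat_carrier[OF W] W ij])
    also have "\<dots> = (\<Sum>k<n. vec_index (ws!j) k * cnj (vec_index (ws!i) k)) / of_real (sqrt (N i) * sqrt (N j))"
      unfolding sum_divide_distrib
      by (intro sum.cong refl) (simp add: ij adjoint_mat_def W_def)
    also have "(\<Sum>k<n. vec_index (ws!j) k * cnj (vec_index (ws!i) k)) = ws!j \<bullet>c ws!i"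
      using cscalar_prod_sum[OF wsc[OF ij(2)] wsc[OF ij(1)]] by simp
    also have "\<dots> / of_real (sqrt (N i) * sqrt (N j)) = 1\<^sub>m n $$ (i,j)"
    proof (cases "i = j")
      case True
      then show ?thesis using NN[OF ij(2)] Npos[OF ij(2)] ij by simp
    next
      case False
      then show ?thesis using corthogonalD[OF ws(2), of j i] ij ws(3) by auto
    qed
    finally show "(adjoint_mat W * W) $$ (i,j) = 1\<^sub>m n $$ (i,j)" .
  qed (use W in \<open>auto simp: adjoint_mat_def\<close>)
  moreover have "W $$ (i,0) = (1 / of_real (sqrt (N 0))) * vec_index v i" if "i < n" for i
  proof -
    have "ws \<noteq> []" using n0 ws(3) by auto
    then have "ws ! 0 = v" using hdws hd_conv_nth by metis
    then show ?thesis using that by (simp add: W_def)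
  qed
  ultimately show ?thesis using that W by blast
qed

text \<open>Deflation: in an orthonormal basis whose first vector is an eigenvector, the first
  column of \<open>A'\<close> is \<open>e\<close> times the first unit vector. Hermitian symmetry
  clears the first row as well and makes \<open>e\<close> real, so the remaining block is again
  Hermitian and the induction hypothesis diagonalises it.\<close>

lemma hermitian_spectral_theorem:
  fixes A :: "complex mat"
  assumes "A \<in> carrier_mat n n" "adjoint_mat A = A"
  shows "\<exists>U D. U \<in> carrier_mat n n \<and> D \<in> carrier_mat n n \<and> adjoint_mat U * U = 1\<^sub>m n \<and>
    (\<forall>i<n. \<forall>j<n. i \<noteq> j \<longrightarrow> D $$ (i,j) = 0) \<and> (\<forall>i<n. Im (D $$ (i,i)) = 0) \<and> A = U * D * adjoint_mat U"
  using assms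
proof (induction n arbitrary: A)
  case 0
  then show ?case
    by (intro exI[of _ "1\<^sub>m 0"]) (auto intro!: eq_matI simp: adjoint_mat_def)
next
  case (Suc m)
  note A = Suc.prems(1)
  obtain as where "char_poly A = (\<Prod>a\<leftarrow>as. [:- a, 1:])" "length as = Suc m"
    using char_poly_factorized[OF A] by blast
  then obtain e where "poly (char_poly A) e = 0" by (cases as) (auto simp: poly_prod_list)
  then have "eigenvalue A e" unfolding eigenvalue_root_char_poly[OF A] .
  then obtain v where v: "v \<in> carrier_vec (Suc m)" "v \<noteq> 0\<^sub>v (Suc m)" and ev: "A *\<^sub>v v = e \<cdot>\<^sub>v v"
    using A unfolding eigenvalue_def eigenvector_def by auto
  obtain W c where W: "W \<in> carrier_mat (Suc m) (Suc m)" and WW: "adjoint_mat W * W = 1\<^sub>m (Suc m)"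
    and W0: "\<And>i. i < Suc m \<Longrightarrow> W $$ (i,0) = c * vec_index v i"
    using unitary_with_first_column[OF v] by blast
  note aW = adjoint_mat_carrier[OF W]
  have WW': "W * adjoint_mat W = 1\<^sub>m (Suc m)"
    using mat_mult_left_right_inverse[OF aW W WW] .
  define A' where "A' = adjoint_mat W * (A * W)"
  have A': "A' \<in> carrier_mat (Suc m) (Suc m)" unfolding A'_def by (rule mult_carrier_mat[OF aW mult_carrier_mat[OF A W]])
  have adjadj: "adjoint_mat (adjoint_mat W) = W"
    using W by (intro eq_matI) (auto simp: adjoint_mat_def)
  have hA': "adjoint_mat A' = A'"
    unfolding A'_def adjoint_mat_mult[OF aW mult_carrier_mat[OF A W]] adjoint_mat_mult[OF A W] adjadj Suc.prems(2)
    by (rule assoc_mult_mat[OF aW A W])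
  have AW0: "(A * W) $$ (i,0) = e * W $$ (i,0)" if i: "i < Suc m" for i
  proof -
    have "(A * W) $$ (i,0) = (\<Sum>k<Suc m. A $$ (i,k) * W $$ (k,0))"
      by (rule index_mult_mat_sum[OF A W i]) simp
    also have "\<dots> = c * (\<Sum>k<Suc m. A $$ (i,k) * vec_index v k)"
      unfolding sum_distrib_left by (intro sum.cong refl) (simp add: W0)
    also have "(\<Sum>k<Suc m. A $$ (i,k) * vec_index v k) = vec_index (A *\<^sub>v v) i"
      using A v i by (auto simp: scalar_prod_def lessThan_atLeast0 intro!: sum.cong)
    also have "\<dots> = e * vec_index v i" unfolding ev using v i by simp
    finally show ?thesis using W0[OF i] by simp
  qed
  have A'0: "A' $$ (i,0) = (if i = 0 then e else 0)" if i: "i < Suc m" for i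
  proof -
    have "A' $$ (i,0) = (\<Sum>k<Suc m. adjoint_mat W $$ (i,k) * (A * W) $$ (k,0))"
      unfolding A'_def by (rule index_mult_mat_sum[OF aW mult_carrier_mat[OF A W] i]) simp
    also have "\<dots> = e * (\<Sum>k<Suc m. adjoint_mat W $$ (i,k) * W $$ (k,0))"
      unfolding sum_distrib_left by (intro sum.cong refl) (simp add: AW0)
    also have "(\<Sum>k<Suc m. adjoint_mat W $$ (i,k) * W $$ (k,0)) = (adjoint_mat W * W) $$ (i,0)"
      by (rule index_mult_mat_sum[OF aW W i, symmetric]) simp
    finally show ?thesis unfolding WW using i by simp
  qed
  have herm': "A' $$ (i,j) = cnj (A' $$ (j,i))" if "i < Suc m" "j < Suc m" for i j
    using adjoint_mat_index[OF A' that] hA' by simp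
  have ime: "Im e = 0" using herm'[of 0 0] A'0[of 0] by (metis complex_cnj_cancel_iff cnj.simps(2) equal_neg_zero zero_less_Suc)
  have A'0': "A' $$ (0,i) = (if i = 0 then e else 0)" if i: "i < Suc m" for i
    using herm'[of 0 i] A'0[OF i] A'0[of 0] i by auto
  define A3 where "A3 = Matrix.mat m m (\<lambda>(i,j). A' $$ (Suc i, Suc j))"
  have A3: "A3 \<in> carrier_mat m m" by (simp add: A3_def)
  have "adjoint_mat A3 = A3"
    by (rule eq_matI) (auto simp: adjoint_mat_def A3_def herm'[symmetric])
  from Suc.IH[OF A3 this] obtain U3 D3 where U3: "U3 \<in> carrier_mat m m" and D3: "D3 \<in> carrier_mat m m"
    and UU3: "adjoint_mat U3 * U3 = 1\<^sub>m m" and off: "\<And>i j. i < m \<Longrightarrow> j < m \<Longrightarrow> i \<noteq> j \<Longrightarrow> D3 $$ (i,j) = 0"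
    and im3: "\<And>i. i < m \<Longrightarrow> Im (D3 $$ (i,i)) = 0" and A3eq: "A3 = U3 * D3 * adjoint_mat U3" by blast
  let ?e = "Matrix.mat 1 1 (\<lambda>_. e)" 
  define V where "V = four_block_mat (1\<^sub>m 1) (0\<^sub>m 1 m) (0\<^sub>m m 1) U3"
  define D where "D = four_block_mat ?e (0\<^sub>m 1 m) (0\<^sub>m m 1) D3"
  have aV: "adjoint_mat V = four_block_mat (1\<^sub>m 1) (0\<^sub>m 1 m) (0\<^sub>m m 1) (adjoint_mat U3)"
    using U3 by (intro eq_matI) (auto simp: adjoint_mat_def V_def)
  have V: "V \<in> carrier_mat (Suc m) (Suc m)" unfolding V_def using four_block_carrier_mat[OF one_carrier_mat[of 1] U3] by simp
  have D: "D \<in> carrier_mat (Suc m) (Suc m)" unfolding D_def using four_block_carrier_mat[of ?e 1 1, OF _ D3] by simp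
  have A'b: "A' = four_block_mat ?e (0\<^sub>m 1 m) (0\<^sub>m m 1) A3"
    by (rule eq_matI) (use A' A'0 A'0' in \<open>auto simp: A3_def\<close>)
  note aV' = adjoint_mat_carrier[OF V]
  have VV: "adjoint_mat V * V = 1\<^sub>m (Suc m)"
  proof -
    have "adjoint_mat V * V = four_block_mat (1\<^sub>m 1) (0\<^sub>m 1 m) (0\<^sub>m m 1) (1\<^sub>m m)"
      unfolding aV unfolding V_def
      by (subst mult_four_block_mat[of _ 1 1 _ m _ m _ _ 1 _ m]) (use U3 UU3 right_mult_zero_mat[OF adjoint_mat_carrier[OF U3], of 1] in auto)
    then show ?thesis by simp
  qed
  have VDV: "V * D * adjoint_mat V = A'"
  proof -
    have VD: "V * D = four_block_mat ?e (0\<^sub>m 1 m) (0\<^sub>m m 1) (U3 * D3)"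
      unfolding D_def V_def
      by (subst mult_four_block_mat[of _ 1 1 _ m _ m _ _ 1 _ m]) (use U3 D3 in auto)
    moreover have "U3 * D3 * adjoint_mat U3 \<in> carrier_mat m m"
      by (rule mult_carrier_mat[OF mult_carrier_mat[OF U3 D3] adjoint_mat_carrier[OF U3]])
    ultimately have "V * D * adjoint_mat V = four_block_mat ?e (0\<^sub>m 1 m) (0\<^sub>m m 1) (U3 * D3 * adjoint_mat U3)"
      unfolding aV VD using U3 D3
      by (subst mult_four_block_mat[of _ 1 1 _ m _ m _ _ 1 _ m])
        (simp_all add: left_mult_zero_mat[OF adjoint_mat_carrier[OF U3]])
    then show ?thesis unfolding A'b A3eq .
  qed
  define U where "U = W * V"
  have U: "U \<in> carrier_mat (Suc m) (Suc m)" unfolding U_def using W V by (rule mult_carrier_mat)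
  have aU: "adjoint_mat U = adjoint_mat V * adjoint_mat W" unfolding U_def by (rule adjoint_mat_mult[OF W V])
  have "adjoint_mat U * U = adjoint_mat V * (adjoint_mat W * W) * V"
    unfolding aU unfolding U_def using W V aW aV'
    by (simp add: assoc_mult_mat[of _ "Suc m" "Suc m" _ "Suc m" _ "Suc m"] mult_carrier_mat[of _ "Suc m" "Suc m" _ "Suc m"])
  then have UU: "adjoint_mat U * U = 1\<^sub>m (Suc m)" unfolding WW using VV aV' by simp
  have "U * D * adjoint_mat U = W * (V * D * adjoint_mat V) * adjoint_mat W"
    unfolding aU unfolding U_def using W V aW aV' D
    by (simp add: assoc_mult_mat[of _ "Suc m" "Suc m" _ "Suc m" _ "Suc m"] mult_carrier_mat[of _ "Suc m" "Suc m" _ "Suc m"])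
  also have "\<dots> = (W * adjoint_mat W) * A * (W * adjoint_mat W)"
    unfolding VDV A'_def using W aW A
    by (simp add: assoc_mult_mat[of _ "Suc m" "Suc m" _ "Suc m" _ "Suc m"] mult_carrier_mat[of _ "Suc m" "Suc m" _ "Suc m"])
  also have "\<dots> = A" unfolding WW' using A by simp
  finally have AU: "A = U * D * adjoint_mat U" by simp
  have "D $$ (i,j) = 0" if "i < Suc m" "j < Suc m" "i \<noteq> j" for i j
    using that off[of "i-1" "j-1"] D3 unfolding D_def by auto
  moreover have "Im (D $$ (i,i)) = 0" if "i < Suc m" for i
    using that im3[of "i-1"] ime D3 unfolding D_def by auto
  ultimately show ?case using U D UU AU by blast
qed

lemma proots_linear_factors: "proots (\<Prod>a\<leftarrow>as. [:- a, 1:]) = mset (as :: complex list)"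
proof (induction as)
  case (Cons a as)
  have "(\<Prod>a\<leftarrow>as. [:- a, 1:]) \<noteq> 0" by (auto simp: prod_list_zero_iff)
  then have "proots ([:- a, 1:] * (\<Prod>a\<leftarrow>as. [:- a, 1:])) = {#a#} + mset as"
    using Cons by (subst proots_mult) auto
  then show ?case by simp
qed simp

lemma sq_minus_unitary_diagonal:
  assumes U: "U \<in> carrier_mat n n" and D: "D \<in> carrier_mat n n" and UU: "adjoint_mat U * U = 1\<^sub>m n"
    and off: "\<forall>i<n. \<forall>j<n. i \<noteq> j \<longrightarrow> D $$ (i,j) = 0" and im: "\<forall>i<n. Im (D $$ (i,i)) = 0"
    and A: "A = U * D * adjoint_mat U"
  shows "sq_minus A = card {i. i < n \<and> Re (D $$ (i,i)) < 0}"
proof -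
  note aU = adjoint_mat_carrier[OF U]
  have Ac: "A \<in> carrier_mat n n" unfolding A by (rule mult_carrier_mat[OF mult_carrier_mat[OF U D] aU])
  have "similar_mat_wit A D U (adjoint_mat U)"
    by (rule similar_mat_witI[OF mat_mult_left_right_inverse[OF aU U UU] UU A Ac D U aU])
  then have "char_poly A = char_poly D" by (intro char_poly_similar) (auto simp: similar_mat_def)
  also have "\<dots> = (\<Prod>a\<leftarrow>diag_mat D. [:- a, 1:])"
    by (rule char_poly_upper_triangular[OF D]) (use off D in \<open>auto simp: upper_triangular_def\<close>)
  also have "proots \<dots> = mset (diag_mat D)" by (rule proots_linear_factors)
  finally have "sq_minus A = length (filter (\<lambda>x. Im x = 0 \<and> Re x < 0) (diag_mat D))"
    unfolding sq_minus_def by (metis mset_filter size_mset)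
  also have "diag_mat D = map (\<lambda>i. D $$ (i,i)) [0..<n]" using D by (auto simp: diag_mat_def)
  also have "length (filter (\<lambda>x. Im x = 0 \<and> Re x < 0) (map (\<lambda>i. D $$ (i,i)) [0..<n])) =
      card (set (filter (\<lambda>i. Re (D $$ (i,i)) < 0) [0..<n]))"
    unfolding filter_map comp_def length_map
    by (subst distinct_card) (use im in \<open>auto intro!: arg_cong[where f = length] filter_cong\<close>)
  finally show ?thesis by (simp add: conj_commute)
qed

section \<open>Negative squares of Hermitian kernels\<close>

text \<open>Kernels on finite sets take the place of matrices, so that points can be added and
  removed without reindexing. The coefficient vector acts from the left, as a row.\<close>

definition herm_form :: "('a \<Rightarrow> 'a \<Rightarrow> complex) \<Rightarrow> 'a set \<Rightarrow> ('a \<Rightarrow> complex) \<Rightarrow> ('a \<Rightarrow> complex) \<Rightarrow> complex" where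
  "herm_form K A c d = (\<Sum>z\<in>A. \<Sum>w\<in>A. c z * K z w * cnj (d w))"

definition hermitian_on :: "('a \<Rightarrow> 'a \<Rightarrow> complex) \<Rightarrow> 'a set \<Rightarrow> bool" where
  "hermitian_on K A \<longleftrightarrow> (\<forall>z\<in>A. \<forall>w\<in>A. K w z = cnj (K z w))"

definition psd_on :: "('a \<Rightarrow> 'a \<Rightarrow> complex) \<Rightarrow> 'a set \<Rightarrow> bool" where
  "psd_on K A \<longleftrightarrow> (\<forall>c. 0 \<le> Re (herm_form K A c c))"

text \<open>A linear dependency among the \<open>v i\<close> on \<open>A\<close> would give the
  value 0, so the condition includes independence: the \<open>v i\<close> span a negative definite
  subspace of dimension \<open>k\<close>.\<close>

definition negative_family :: "('a \<Rightarrow> 'a \<Rightarrow> complex) \<Rightarrow> 'a set \<Rightarrow> nat \<Rightarrow> (nat \<Rightarrow> 'a \<Rightarrow> complex) \<Rightarrow> bool" where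
  "negative_family K A k v \<longleftrightarrow> (\<forall>\<alpha>. (\<exists>i<k. \<alpha> i \<noteq> 0) \<longrightarrow>
     Re (herm_form K A (\<lambda>z. \<Sum>i<k. \<alpha> i * v i z) (\<lambda>z. \<Sum>i<k. \<alpha> i * v i z)) < 0)"

text \<open>This means at least \<open>k\<close> negative squares; the exact number is expressed
  together with the negation for \<open>Suc k\<close>.\<close>

definition has_negative_squares :: "('a \<Rightarrow> 'a \<Rightarrow> complex) \<Rightarrow> 'a set \<Rightarrow> nat \<Rightarrow> bool" where
  "has_negative_squares K A k \<longleftrightarrow> (\<exists>v. negative_family K A k v)"

lemma herm_form_cong:
  assumes "\<And>z. z \<in> A \<Longrightarrow> c z = c' z" "\<And>z. z \<in> A \<Longrightarrow> d z = d' z"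
  shows "herm_form K A c d = herm_form K A c' d'"
  unfolding herm_form_def by (intro sum.cong refl) (simp add: assms)

lemma herm_form_add_left: "herm_form K A (\<lambda>z. c z + c' z) d = herm_form K A c d + herm_form K A c' d"
  by (simp add: herm_form_def sum.distrib algebra_simps)

lemma herm_form_add_right: "herm_form K A c (\<lambda>z. d z + d' z) = herm_form K A c d + herm_form K A c d'"
  by (simp add: herm_form_def sum.distrib algebra_simps)

lemma herm_form_scale_left: "herm_form K A (\<lambda>z. a * c z) d = a * herm_form K A c d"
  by (simp add: herm_form_def sum_distrib_left mult.assoc)

lemma herm_form_scale_right: "herm_form K A c (\<lambda>z. a * d z) = cnj a * herm_form K A c d"
  by (simp add: herm_form_def sum_distrib_left mult_ac)

lemma herm_form_sum_right: "herm_form K A c (\<lambda>z. \<Sum>i\<in>I. d i z) = (\<Sum>i\<in>I. herm_form K A c (d i))"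
proof (cases "finite I")
  case True
  then show ?thesis
    by (induction rule: finite_induct) (simp_all add: herm_form_add_right, simp add: herm_form_def)
qed (simp add: herm_form_def)

lemma herm_form_flip:
  assumes "hermitian_on K A"
  shows "herm_form K A d c = cnj (herm_form K A c d)"
proof -
  have "herm_form K A d c = (\<Sum>w\<in>A. \<Sum>z\<in>A. d z * K z w * cnj (c w))"
    unfolding herm_form_def by (rule sum.swap)
  also have "\<dots> = cnj (herm_form K A c d)"
    unfolding herm_form_def cnj_sum
  proof (intro sum.cong refl)
    fix x y assume "x \<in> A" "y \<in> A"
    then have "K y x = cnj (K x y)" using assms unfolding hermitian_on_def by blast
    then show "d y * K y x * cnj (c x) = cnj (c x * K x y * cnj (d y))" by simp
  qed
  finally show ?thesis .
qed

lemma herm_form_restrict: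
  assumes "finite A" "B \<subseteq> A" "\<And>z. z \<in> A - B \<Longrightarrow> c z = 0" "\<And>z. z \<in> A - B \<Longrightarrow> d z = 0"
  shows "herm_form K A c d = herm_form K B c d"
proof -
  have "herm_form K A c d = (\<Sum>z\<in>B. \<Sum>w\<in>A. c z * K z w * cnj (d w))"
    unfolding herm_form_def by (rule sum.mono_neutral_right) (use assms in auto)
  also have "\<dots> = herm_form K B c d"
    unfolding herm_form_def by (intro sum.cong refl sum.mono_neutral_right) (use assms in auto)
  finally show ?thesis .
qed

lemma hermitian_on_subset: "hermitian_on K A \<Longrightarrow> B \<subseteq> A \<Longrightarrow> hermitian_on K B"
  unfolding hermitian_on_def by blast

lemma negative_family_extend_zero:
  assumes v: "negative_family K B k v" and "B \<subseteq> A" "finite A"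
  shows "negative_family K A k (\<lambda>i z. if z \<in> B then v i z else 0)"
proof -
  define w where "w i z = (if z \<in> B then v i z else 0)" for i z
  have "herm_form K A (\<lambda>z. \<Sum>i<k. \<alpha> i * w i z) (\<lambda>z. \<Sum>i<k. \<alpha> i * w i z) =
      herm_form K B (\<lambda>z. \<Sum>i<k. \<alpha> i * v i z) (\<lambda>z. \<Sum>i<k. \<alpha> i * v i z)" for \<alpha>
  proof -
    have "herm_form K A (\<lambda>z. \<Sum>i<k. \<alpha> i * w i z) (\<lambda>z. \<Sum>i<k. \<alpha> i * w i z) =
      herm_form K B (\<lambda>z. \<Sum>i<k. \<alpha> i * w i z) (\<lambda>z. \<Sum>i<k. \<alpha> i * w i z)"
      by (rule herm_form_restrict[OF assms(3,2)]) (auto simp: w_def)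
    also have "\<dots> = herm_form K B (\<lambda>z. \<Sum>i<k. \<alpha> i * v i z) (\<lambda>z. \<Sum>i<k. \<alpha> i * v i z)"
      by (rule herm_form_cong) (auto simp: w_def)
    finally show ?thesis .
  qed
  then have "negative_family K A k w" using v by (simp add: negative_family_def)
  then show ?thesis by (simp add: w_def[abs_def])
qed

lemma has_negative_squares_mono:
  "has_negative_squares K B k \<Longrightarrow> B \<subseteq> A \<Longrightarrow> finite A \<Longrightarrow> has_negative_squares K A k"
  unfolding has_negative_squares_def using negative_family_extend_zero by metis

lemma has_negative_squares_le:
  assumes "has_negative_squares K A k" "j \<le> k"
  shows "has_negative_squares K A j"
proof -
  obtain v where v: "negative_family K A k v" using assms by (auto simp: has_negative_squares_def)
  have "Re (herm_form K A (\<lambda>z. \<Sum>i<j. \<alpha> i * v i z) (\<lambda>z. \<Sum>i<j. \<alpha> i * v i z)) < 0"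
    if "\<exists>i<j. \<alpha> i \<noteq> 0" for \<alpha>
  proof -
    define \<beta> where "\<beta> i = (if i < j then \<alpha> i else 0)" for i
    have "(\<Sum>i<k. \<beta> i * v i z) = (\<Sum>i<j. \<alpha> i * v i z)" for z
      by (rule sum.mono_neutral_cong_right) (use assms(2) in \<open>auto simp: \<beta>_def\<close>)
    moreover have "\<exists>i<k. \<beta> i \<noteq> 0" using that assms(2) by (auto simp: \<beta>_def)
    ultimately show ?thesis using v[unfolded negative_family_def, rule_format, of \<beta>] by simp
  qed
  then show ?thesis unfolding has_negative_squares_def negative_family_def by blast
qed

lemma has_negative_squares_0 [simp]: "has_negative_squares K A 0"
  by (simp add: has_negative_squares_def negative_family_def)

text \<open>A zero last row pads the \<open>k\<close> equations in \<open>Suc k\<close> unknowns to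
  a square matrix, which is singular.\<close>

lemma homogeneous_system_nontrivial_solution:
  fixes a :: "nat \<Rightarrow> nat \<Rightarrow> complex"
  shows "\<exists>\<alpha>. (\<exists>i<Suc k. \<alpha> i \<noteq> 0) \<and> (\<forall>r<k. (\<Sum>i<Suc k. a r i * \<alpha> i) = 0)"
proof -
  define A where "A = Matrix.mat (Suc k) (Suc k) (\<lambda>(r,i). if r < k then a r i else 0)"
  have A: "A \<in> carrier_mat (Suc k) (Suc k)" by (simp add: A_def)
  have "Determinant.det A = (\<Sum>j<Suc k. A $$ (k,j) * cofactor A k j)"
    by (rule laplace_expansion_row[OF A]) simp
  then have "Determinant.det A = 0" by (simp add: A_def)
  then obtain v where v: "v \<in> carrier_vec (Suc k)" "v \<noteq> 0\<^sub>v (Suc k)" "A *\<^sub>v v = 0\<^sub>v (Suc k)"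
    using det_0_iff_vec_prod_zero[OF A] by blast
  have "\<exists>i<Suc k. vec_index v i \<noteq> 0"
    using v(1,2) by (metis eq_vecI carrier_vecD index_zero_vec)
  moreover have "(\<Sum>i<Suc k. a r i * vec_index v i) = 0" if r: "r < k" for r
  proof -
    have "(\<Sum>i<Suc k. a r i * vec_index v i) = vec_index (A *\<^sub>v v) r"
      using A v(1) r by (auto simp: A_def scalar_prod_def lessThan_atLeast0 intro!: sum.cong)
    then show ?thesis using v(3) r by simp
  qed
  ultimately show ?thesis by blast
qed

text \<open>Dimension count: a negative definite subspace of dimension \<open>Suc k\<close> would
  contain a nonzero vector on which all \<open>k\<close> functionals \<open>l i\<close>
  vanish.\<close>

lemma not_has_negative_squares_Suc:
  assumes "\<And>c. \<forall>i<k. (\<Sum>z\<in>A. l i z * c z) = 0 \<Longrightarrow> 0 \<le> Re (herm_form K A c c)"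
  shows "\<not> has_negative_squares K A (Suc k)"
proof
  assume "has_negative_squares K A (Suc k)"
  then obtain v where v: "negative_family K A (Suc k) v" by (auto simp: has_negative_squares_def)
  obtain \<alpha> where \<alpha>: "\<exists>i<Suc k. \<alpha> i \<noteq> 0" "\<forall>r<k. (\<Sum>i<Suc k. (\<Sum>z\<in>A. l r z * v i z) * \<alpha> i) = 0"
    using homogeneous_system_nontrivial_solution[of k "\<lambda>r i. \<Sum>z\<in>A. l r z * v i z"] by blast
  have "\<forall>r<k. (\<Sum>z\<in>A. l r z * (\<Sum>i<Suc k. \<alpha> i * v i z)) = 0"
  proof (intro allI impI)
    fix r assume "r < k"
    have "(\<Sum>z\<in>A. l r z * (\<Sum>i<Suc k. \<alpha> i * v i z)) = (\<Sum>z\<in>A. \<Sum>i<Suc k. l r z * v i z * \<alpha> i)"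
      by (simp only: sum_distrib_left mult_ac)
    also have "\<dots> = (\<Sum>i<Suc k. (\<Sum>z\<in>A. l r z * v i z) * \<alpha> i)"
      by (subst sum.swap) (simp only: sum_distrib_right)
    finally show "(\<Sum>z\<in>A. l r z * (\<Sum>i<Suc k. \<alpha> i * v i z)) = 0" using \<alpha>(2) \<open>r < k\<close> by simp
  qed
  from assms[OF this] show False
    using v \<alpha>(1) unfolding negative_family_def by (meson not_less)
qed

lemma herm_form_orthogonal_add:
  assumes h: "hermitian_on K A" and o: "herm_form K A c d = 0"
  shows "herm_form K A (\<lambda>z. c z + d z) (\<lambda>z. c z + d z) = herm_form K A c c + herm_form K A d d"
  using herm_form_flip[OF h, of c d] herm_form_flip[OF h, of d c] o by (simp add: herm_form_add_left herm_form_add_right)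

text \<open>On an orthogonal sum the forms add, so the line of \<open>c\<close> enlarges the
  negative definite span of the \<open>v i\<close> by one dimension.\<close>

lemma negative_family_extend:
  assumes h: "hermitian_on K A" and v: "negative_family K A k v"
    and o: "\<forall>i<k. herm_form K A c (v i) = 0" and c: "Re (herm_form K A c c) < 0"
  shows "has_negative_squares K A (Suc k)"
proof -
  define w where "w = v(k := c)"
  have "Re (herm_form K A (\<lambda>z. \<Sum>i<Suc k. \<alpha> i * w i z) (\<lambda>z. \<Sum>i<Suc k. \<alpha> i * w i z)) < 0"
    if "\<exists>i<Suc k. \<alpha> i \<noteq> 0" for \<alpha>
  proof -
    let ?s = "\<lambda>z. \<Sum>i<k. \<alpha> i * v i z"
    let ?t = "\<lambda>z. \<alpha> k * c z"
    have eq: "(\<lambda>z. \<Sum>i<Suc k. \<alpha> i * w i z) = (\<lambda>z. ?t z + ?s z)" by (auto simp: w_def)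
    have "herm_form K A ?t ?s = \<alpha> k * (\<Sum>i<k. cnj (\<alpha> i) * herm_form K A c (v i))"
      by (simp only: herm_form_scale_left herm_form_sum_right herm_form_scale_right)
    then have "herm_form K A ?t ?s = 0" using o by simp
    then have F: "herm_form K A (\<lambda>z. ?t z + ?s z) (\<lambda>z. ?t z + ?s z) = herm_form K A ?t ?t + herm_form K A ?s ?s"
      by (rule herm_form_orthogonal_add[OF h])
    have T: "herm_form K A ?t ?t = of_real ((cmod (\<alpha> k))^2) * herm_form K A c c"
      by (simp add: herm_form_scale_left herm_form_scale_right complex_norm_square mult_ac del: of_real_power)
    have ReT: "Re (herm_form K A ?t ?t) = (cmod (\<alpha> k))^2 * Re (herm_form K A c c)" unfolding T by simp
    show ?thesis
    proof (cases "\<exists>i<k. \<alpha> i \<noteq> 0")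
      case True
      then have "Re (herm_form K A ?s ?s) < 0" using v unfolding negative_family_def by blast
      moreover have "Re (herm_form K A ?t ?t) \<le> 0" unfolding ReT using c by (simp add: mult_le_0_iff)
      ultimately show ?thesis unfolding eq F by simp
    next
      case False
      then have "\<alpha> k \<noteq> 0" using that by (metis less_Suc_eq)
      then have "Re (herm_form K A ?t ?t) < 0" unfolding ReT using c by (simp add: mult_less_0_iff)
      moreover have "herm_form K A ?s ?s = 0" using False by (simp add: herm_form_def)
      ultimately show ?thesis unfolding eq F by simp
    qed
  qed
  then show ?thesis unfolding has_negative_squares_def negative_family_def by blast
qed

section \<open>Nondegenerate subsets and Schur complements\<close>

definition nondegenerate_on :: "('a \<Rightarrow> 'a \<Rightarrow> complex) \<Rightarrow> 'a set \<Rightarrow> bool" where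
  "nondegenerate_on K B \<longleftrightarrow> (\<forall>c. (\<forall>w\<in>B. (\<Sum>z\<in>B. c z * K z w) = 0) \<longrightarrow> (\<forall>z\<in>B. c z = 0))"

lemma herm_form_radical_left:
  assumes "\<forall>w\<in>A. (\<Sum>z\<in>A. u z * K z w) = 0"
  shows "herm_form K A u d = 0"
proof -
  have "herm_form K A u d = (\<Sum>w\<in>A. \<Sum>z\<in>A. u z * K z w * cnj (d w))"
    unfolding herm_form_def by (rule sum.swap)
  also have "\<dots> = 0" using assms by (simp flip: sum_distrib_right)
  finally show ?thesis .
qed

lemma has_negative_squares_nondegenerate_subset:
  assumes "finite A" "hermitian_on K A" "has_negative_squares K A k"
  shows "\<exists>B\<subseteq>A. has_negative_squares K B k \<and> nondegenerate_on K B"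
  using assms
proof (induction A rule: finite_psubset_induct)
  case (psubset A)
  show ?case
  proof (cases "nondegenerate_on K A")
    case True
    then show ?thesis using psubset by blast
  next
    case False
    then obtain u p where u: "\<forall>w\<in>A. (\<Sum>z\<in>A. u z * K z w) = 0" and p: "p \<in> A" "u p \<noteq> 0"
      unfolding nondegenerate_on_def by blast
    obtain v where v: "negative_family K A k v" using psubset.prems by (auto simp: has_negative_squares_def)
    define w where "w i z = v i z + (- v i p / u p) * u z" for i z
    have "herm_form K (A - {p}) (\<lambda>z. \<Sum>i<k. \<alpha> i * w i z) (\<lambda>z. \<Sum>i<k. \<alpha> i * w i z) =
        herm_form K A (\<lambda>z. \<Sum>i<k. \<alpha> i * v i z) (\<lambda>z. \<Sum>i<k. \<alpha> i * v i z)" for \<alpha>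
    proof -
      let ?c = "\<lambda>z. \<Sum>i<k. \<alpha> i * v i z"
      let ?d = "\<lambda>z. (\<Sum>i<k. \<alpha> i * (- v i p / u p)) * u z"
      have eq: "(\<lambda>z. \<Sum>i<k. \<alpha> i * w i z) = (\<lambda>z. ?d z + ?c z)"
        by (rule ext) (simp only: w_def distrib_left sum.distrib sum_distrib_right mult.assoc add.commute)
      have z: "herm_form K A ?d e = 0" for e
        unfolding herm_form_scale_left herm_form_radical_left[OF u] by simp
      have "(\<Sum>i<k. \<alpha> i * w i p) = 0" using p by (simp add: w_def)
      then have "herm_form K (A - {p}) (\<lambda>z. \<Sum>i<k. \<alpha> i * w i z) (\<lambda>z. \<Sum>i<k. \<alpha> i * w i z) =
        herm_form K A (\<lambda>z. \<Sum>i<k. \<alpha> i * w i z) (\<lambda>z. \<Sum>i<k. \<alpha> i * w i z)"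
        by (intro herm_form_restrict[symmetric] psubset.hyps) auto
      also have "\<dots> = herm_form K A ?d ?d + herm_form K A ?c ?c"
        unfolding eq by (rule herm_form_orthogonal_add[OF psubset.prems(1) z])
      finally show ?thesis by (simp only: z add_0)
    qed
    then have "negative_family K (A - {p}) k w" using v unfolding negative_family_def by simp
    then have "has_negative_squares K (A - {p}) k" by (auto simp: has_negative_squares_def)
    moreover have "hermitian_on K (A - {p})" using psubset.prems(1) by (rule hermitian_on_subset) auto
    ultimately obtain B where "B \<subseteq> A - {p}" "has_negative_squares K B k" "nondegenerate_on K B"
      using psubset.IH[of "A - {p}"] p by blast
    then show ?thesis by blast
  qed
qed

lemma nondegenerate_on_left_inverse:
  assumes "finite B" "nondegenerate_on K B"
  obtains M where "\<And>x y. x \<in> B \<Longrightarrow> y \<in> B \<Longrightarrow> (\<Sum>t\<in>B. M x t * K t y) = (if x = y then 1 else 0)"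
proof -
  obtain xs where xs: "set xs = B" "distinct xs" using finite_distinct_list[OF assms(1)] by blast
  define n where "n = length xs"
  have bij: "bij_betw (\<lambda>i. xs ! i) {..<n} B"
    using bij_betw_nth[of xs "{..<n}" B] xs by (simp add: n_def)
  define ix where "ix = the_inv_into {..<n} (\<lambda>i. xs ! i)"
  have inj: "inj_on (\<lambda>i. xs ! i) {..<n}" using bij by (simp add: bij_betw_def)
  have ix: "ix (xs ! i) = i" if "i < n" for i
    unfolding ix_def using the_inv_into_f_f[OF inj] that by simp
  have ix2: "ix x < n \<and> xs ! ix x = x" if "x \<in> B" for x
    using that xs ix by (metis in_set_conv_nth n_def)
  have sumB: "(\<Sum>z\<in>B. g z) = (\<Sum>i<n. g (xs ! i))" for g :: "'a \<Rightarrow> complex"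
    by (rule sum.reindex_bij_betw[OF bij, symmetric])
  \<comment> \<open>Transposed, so that the column kernel of \<open>P\<close> is the left kernel in
    \<open>nondegenerate_on\<close>.\<close>
  define P where "P = Matrix.mat n n (\<lambda>(i,j). K (xs ! j) (xs ! i))"
  have P: "P \<in> carrier_mat n n" by (simp add: P_def)
  have "Determinant.det P \<noteq> 0"
  proof
    assume "Determinant.det P = 0"
    then obtain v where v: "v \<in> carrier_vec n" "v \<noteq> 0\<^sub>v n" "P *\<^sub>v v = 0\<^sub>v n"
      using det_0_iff_vec_prod_zero[OF P] by blast
    define c where "c x = vec_index v (ix x)" for x
    have "(\<Sum>z\<in>B. c z * K z w) = 0" if w: "w \<in> B" for w
    proof -
      have "(\<Sum>z\<in>B. c z * K z w) = (\<Sum>i<n. vec_index v i * K (xs ! i) w)"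
        unfolding sumB by (intro sum.cong refl) (simp add: c_def ix)
      also have "\<dots> = vec_index (P *\<^sub>v v) (ix w)"
        using P v(1) ix2[OF w] by (auto simp: P_def scalar_prod_def lessThan_atLeast0 mult.commute intro!: sum.cong)
      finally show ?thesis using v(3) ix2[OF w] by simp
    qed
    then have "\<forall>z\<in>B. c z = 0" using assms(2) unfolding nondegenerate_on_def by blast
    then have "vec_index v i = 0" if "i < n" for i
      using that xs ix[OF that] unfolding c_def n_def by (metis nth_mem)
    then show False using v(1,2) by (metis eq_vecI carrier_vecD index_zero_vec)
  qed
  then obtain Q where Q: "Q \<in> carrier_mat n n" and PQ: "P * Q = 1\<^sub>m n"
    using det_non_zero_imp_unit[OF P, of "()"] by (auto simp: Units_def ring_mat_def)
  have "(\<Sum>t\<in>B. Q $$ (ix t, ix x) * K t y) = (if x = y then 1 else 0)" if "x \<in> B" "y \<in> B" for x y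
  proof -
    have "(\<Sum>t\<in>B. Q $$ (ix t, ix x) * K t y) = (\<Sum>i<n. P $$ (ix y, i) * Q $$ (i, ix x))"
      unfolding sumB by (intro sum.cong refl) (use ix ix2[OF that(2)] in \<open>auto simp: P_def\<close>)
    also have "\<dots> = (P * Q) $$ (ix y, ix x)"
      by (rule index_mult_mat_sum[OF P Q, symmetric]) (use that ix2 in auto)
    also have "\<dots> = (if x = y then 1 else 0)" unfolding PQ using ix2[OF that(1)] ix2[OF that(2)] by auto
    finally show ?thesis .
  qed
  then show ?thesis using that[of "\<lambda>x t. Q $$ (ix t, ix x)"] by blast
qed

text \<open>With \<open>r z = K(z,B) K(B,B)^-1\<close> this is the classical
  \<open>K(z,w) - K(z,B) K(B,B)^-1 K(B,w)\<close>. Taking \<open>r\<close> as a parameter separates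
  the algebra from the inversion: the lemmas below use only that \<open>r z\<close> expresses the
  row \<open>K z\<close> on \<open>B\<close> by the rows of \<open>B\<close>.\<close>

definition schur_complement :: "('a \<Rightarrow> 'a \<Rightarrow> complex) \<Rightarrow> 'a set \<Rightarrow> ('a \<Rightarrow> 'a \<Rightarrow> complex) \<Rightarrow> 'a \<Rightarrow> 'a \<Rightarrow> complex" where
  "schur_complement K B r z w = K z w - (\<Sum>y\<in>B. r z y * K y w)"

text \<open>The vector supported on \<open>A\<close> that agrees with \<open>c\<close> off \<open>B\<close> and is orthogonal to everything
  supported on \<open>B\<close>; here \<open>r z\<close> are the coordinates of the row \<open>K z\<close> in terms of the rows \<open>K y\<close>, \<open>y \<in> B\<close>.\<close>

definition orth_lift :: "'a set \<Rightarrow> 'a set \<Rightarrow> ('a \<Rightarrow> 'a \<Rightarrow> complex) \<Rightarrow> ('a \<Rightarrow> complex) \<Rightarrow> 'a \<Rightarrow> complex" where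
  "orth_lift A B r c u = (if u \<in> B then - (\<Sum>z\<in>A-B. c z * r z u) else c u)"

text \<open>The sum of column \<open>w\<close> of \<open>K\<close> against the lift equals the sum
  of column \<open>w\<close> of the Schur complement against \<open>c\<close>. It vanishes for
  \<open>w\<close> in \<open>B\<close>, so only \<open>A - B\<close> contributes to either form, and
  there the lift is \<open>c\<close>.\<close>

lemma
  assumes "finite A" "B \<subseteq> A" and r: "\<And>z x. z \<in> A \<Longrightarrow> x \<in> B \<Longrightarrow> (\<Sum>y\<in>B. r z y * K y x) = K z x"
    and h: "hermitian_on K A"
  shows herm_form_orth_lift_right: "\<And>d. (\<And>z. z \<in> A - B \<Longrightarrow> d z = 0) \<Longrightarrow> herm_form K A (orth_lift A B r c) d = 0"
    and herm_form_orth_lift: "herm_form K A (orth_lift A B r c) (orth_lift A B r c) = herm_form (schur_complement K B r) (A - B) c c"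
proof -
  let ?C = "orth_lift A B r c"
  have col: "(\<Sum>u\<in>A. ?C u * K u w) = (\<Sum>z\<in>A-B. c z * schur_complement K B r z w)" for w
  proof -
    have "(\<Sum>u\<in>A. ?C u * K u w) = (\<Sum>u\<in>A-B. ?C u * K u w) + (\<Sum>u\<in>B. ?C u * K u w)"
      using sum.subset_diff[OF assms(2,1)] .
    also have "(\<Sum>u\<in>B. ?C u * K u w) = - (\<Sum>u\<in>B. \<Sum>z\<in>A-B. c z * r z u * K u w)"
      by (simp add: orth_lift_def sum_negf sum_distrib_right)
    also have "(\<Sum>u\<in>B. \<Sum>z\<in>A-B. c z * r z u * K u w) = (\<Sum>z\<in>A-B. c z * (\<Sum>u\<in>B. r z u * K u w))"
      by (subst sum.swap) (simp add: sum_distrib_left mult.assoc)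
    also have "(\<Sum>u\<in>A-B. ?C u * K u w) = (\<Sum>u\<in>A-B. c u * K u w)"
      by (intro sum.cong) (auto simp: orth_lift_def)
    finally show ?thesis by (simp add: schur_complement_def sum_subtractf algebra_simps)
  qed
  have colB: "(\<Sum>u\<in>A. ?C u * K u w) = 0" if "w \<in> B" for w
    unfolding col using r that by (intro sum.neutral) (auto simp: schur_complement_def)
  have form: "herm_form K A ?C d = (\<Sum>w\<in>A. (\<Sum>u\<in>A. ?C u * K u w) * cnj (d w))" for d
    unfolding herm_form_def by (subst sum.swap) (simp add: sum_distrib_right)
  show "herm_form K A ?C d = 0" if "\<And>z. z \<in> A - B \<Longrightarrow> d z = 0" for d
    unfolding form using colB that by (intro sum.neutral) auto
  have "herm_form K A ?C ?C = (\<Sum>w\<in>A-B. (\<Sum>u\<in>A. ?C u * K u w) * cnj (?C w))"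
    unfolding form by (rule sum.mono_neutral_right) (use assms colB in auto)
  also have "\<dots> = (\<Sum>w\<in>A-B. (\<Sum>z\<in>A-B. c z * schur_complement K B r z w) * cnj (c w))"
    unfolding col by (intro sum.cong refl) (auto simp: orth_lift_def)
  also have "\<dots> = herm_form (schur_complement K B r) (A - B) c c"
    unfolding herm_form_def by (subst sum.swap) (simp add: sum_distrib_right)
  finally show "herm_form K A ?C ?C = herm_form (schur_complement K B r) (A - B) c c" .
qed

text \<open>A negative vector of the Schur complement lifts to a negative vector on \<open>A\<close>
  that is orthogonal to everything supported on \<open>B\<close>; together with the \<open>k\<close>
  negative vectors on \<open>B\<close> it would give one negative square too many.\<close>

lemma psd_on_schur_complement:
  assumes "finite A" "B \<subseteq> A" and r: "\<And>z x. z \<in> A \<Longrightarrow> x \<in> B \<Longrightarrow> (\<Sum>y\<in>B. r z y * K y x) = K z x"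
    and h: "hermitian_on K A" and B: "has_negative_squares K B k" and A: "\<not> has_negative_squares K A (Suc k)"
  shows "psd_on (schur_complement K B r) (A - B)"
  unfolding psd_on_def
proof (intro allI, rule ccontr)
  fix c assume "\<not> 0 \<le> Re (herm_form (schur_complement K B r) (A - B) c c)"
  then have neg: "Re (herm_form K A (orth_lift A B r c) (orth_lift A B r c)) < 0"
    using herm_form_orth_lift[of A B r K, OF assms(1,2) r h] by simp
  obtain v where v: "negative_family K B k v" using B by (auto simp: has_negative_squares_def)
  define w where "w i z = (if z \<in> B then v i z else 0)" for i z
  have "negative_family K A k w"
    using negative_family_extend_zero[OF v assms(2,1)] by (simp add: w_def[abs_def])
  moreover have "\<forall>i<k. herm_form K A (orth_lift A B r c) (w i) = 0"
    by (auto intro!: herm_form_orth_lift_right[of A B r K, OF assms(1,2) r h] simp: w_def)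
  ultimately have "has_negative_squares K A (Suc k)" using neg by (intro negative_family_extend[OF h])
  then show False using A by blast
qed

text \<open>The converse, so that together the two lemmas give additivity of inertia. A vector
  \<open>c\<close> orthogonal to the \<open>k\<close> negative vectors of \<open>B\<close> splits
  into its lift \<open>?C\<close> and a part \<open>?e\<close> supported on \<open>B\<close>. The
  form is nonnegative on \<open>?C\<close> because the Schur complement is positive, and on
  \<open>?e\<close> because otherwise \<open>B\<close> would have \<open>Suc k\<close> negative
  squares.\<close>

lemma not_has_negative_squares_schur_complement:
  assumes "finite A" "B \<subseteq> A" and r: "\<And>z x. z \<in> A \<Longrightarrow> x \<in> B \<Longrightarrow> (\<Sum>y\<in>B. r z y * K y x) = K z x"
    and h: "hermitian_on K A" and B: "has_negative_squares K B k" and B': "\<not> has_negative_squares K B (Suc k)"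
    and psd: "psd_on (schur_complement K B r) (A - B)"
  shows "\<not> has_negative_squares K A (Suc k)"
proof -
  obtain v where v: "negative_family K B k v" using B by (auto simp: has_negative_squares_def)
  have hB: "hermitian_on K B" using h assms(2) by (rule hermitian_on_subset)
  define w where "w i z = (if z \<in> B then v i z else 0)" for i z
  show ?thesis
  proof (rule not_has_negative_squares_Suc[where l = "\<lambda>i z. \<Sum>u\<in>A. K z u * cnj (w i u)"])
    fix c assume l: "\<forall>i<k. (\<Sum>z\<in>A. (\<Sum>u\<in>A. K z u * cnj (w i u)) * c z) = 0"
    have l': "herm_form K A c (w i) = 0" if "i < k" for i
    proof -
      have "herm_form K A c (w i) = (\<Sum>z\<in>A. (\<Sum>u\<in>A. K z u * cnj (w i u)) * c z)"
        unfolding herm_form_def by (simp add: sum_distrib_left sum_distrib_right mult_ac)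
      then show ?thesis using l that by simp
    qed
    let ?C = "orth_lift A B r c"
    let ?e = "\<lambda>z. c z - ?C z"
    have e0: "?e z = 0" if "z \<in> A - B" for z using that by (simp add: orth_lift_def)
    have right: "herm_form K A ?C d = 0" if "\<And>z. z \<in> A - B \<Longrightarrow> d z = 0" for d
      using herm_form_orth_lift_right[of A B r K d c, OF assms(1,2) r h that] .
    have "herm_form K B ?e (v i) = 0" if "i < k" for i
    proof -
      have "herm_form K B ?e (v i) = herm_form K B ?e (w i)" by (rule herm_form_cong) (auto simp: w_def)
      also have "\<dots> = herm_form K A ?e (w i)"
        by (rule herm_form_restrict[OF assms(1,2), symmetric]) (auto simp: orth_lift_def w_def)
      also have "\<dots> = herm_form K A c (w i) - herm_form K A ?C (w i)"
        using herm_form_add_left[of K A ?C ?e "w i"] by simp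
      also have "\<dots> = 0" using l'[OF that] right[of "w i"] by (simp add: w_def)
      finally show ?thesis .
    qed
    then have "0 \<le> Re (herm_form K B ?e ?e)"
      using negative_family_extend[OF hB v, of ?e] B' by (meson not_le)
    moreover have "herm_form K B ?e ?e = herm_form K A ?e ?e"
      by (rule herm_form_restrict[OF assms(1,2), symmetric]) (auto simp: orth_lift_def)
    moreover have "herm_form K A c c = herm_form K A ?C ?C + herm_form K A ?e ?e"
      using herm_form_orthogonal_add[OF h right[of ?e, OF e0]] by simp
    moreover have "herm_form K A ?C ?C = herm_form (schur_complement K B r) (A - B) c c"
      by (rule herm_form_orth_lift[of A B r K, OF assms(1,2) r h])
    ultimately show "0 \<le> Re (herm_form K A c c)" using psd unfolding psd_on_def by simp
  qed
qed

section \<open>Negative squares and negative eigenvalues\<close>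

text \<open>In spectral coordinates the form is the sum of \<open>d l * |L l c|^2\<close>. If the
  \<open>m\<close> coordinates with negative \<open>d l\<close> vanish, it is nonnegative, so
  \<open>m\<close> is an upper bound; the corresponding eigenvectors attain it.\<close>

lemma has_negative_squares_iff_sq_minus:
  fixes K :: "'a \<Rightarrow> 'a \<Rightarrow> complex"
  assumes dist: "distinct zs" and herm: "hermitian_on K (set zs)"
  shows "has_negative_squares K (set zs) k \<longleftrightarrow>
    k \<le> sq_minus (Matrix.mat (length zs) (length zs) (\<lambda>(i,j). K (zs!i) (zs!j)))"
proof -
  define n where "n = length zs"
  define A where "A = Matrix.mat n n (\<lambda>(i,j). K (zs!i) (zs!j))"
  have A: "A \<in> carrier_mat n n" by (simp add: A_def)
  have "adjoint_mat A = A"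
  proof (rule eq_matI)
    fix i j assume "i < dim_row A" "j < dim_col A"
    then have ij: "i < n" "j < n" using A by auto
    then have "K (zs!i) (zs!j) = cnj (K (zs!j) (zs!i))"
      using herm nth_mem[of i zs] nth_mem[of j zs] unfolding hermitian_on_def n_def by blast
    then show "adjoint_mat A $$ (i,j) = A $$ (i,j)" using ij by (simp add: A_def adjoint_mat_def)
  qed (use A in \<open>auto simp: adjoint_mat_def\<close>)
  then obtain U D where U: "U \<in> carrier_mat n n" and D: "D \<in> carrier_mat n n" and UU: "adjoint_mat U * U = 1\<^sub>m n"
    and off: "\<forall>i<n. \<forall>j<n. i \<noteq> j \<longrightarrow> D $$ (i,j) = 0" and im: "\<forall>i<n. Im (D $$ (i,i)) = 0"
    and AU: "A = U * D * adjoint_mat U"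
    using hermitian_spectral_theorem[OF A] by blast
  define d where "d i = Re (D $$ (i,i))" for i
  define S where "S = {i. i < n \<and> d i < 0}"
  define m where "m = card S"
  have sq: "sq_minus A = m"
    unfolding m_def S_def d_def by (rule sq_minus_unitary_diagonal[OF U D UU off im AU])
  have orth: "(\<Sum>j<n. cnj (U $$ (j,i)) * U $$ (j,l)) = (if i = l then 1 else 0)" if "i < n" "l < n" for i l
  proof -
    have "(\<Sum>j<n. cnj (U $$ (j,i)) * U $$ (j,l)) = (adjoint_mat U * U) $$ (i,l)"
      unfolding index_mult_mat_sum[OF adjoint_mat_carrier[OF U] U that]
      by (intro sum.cong refl) (simp add: adjoint_mat_index[OF U] that)
    then show ?thesis unfolding UU using that by simp
  qed
  have entry: "K (zs!j) (zs!l) = (\<Sum>i<n. U $$ (j,i) * of_real (d i) * cnj (U $$ (l,i)))" if "j < n" "l < n" for j l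
  proof -
    have UD: "(U * D) $$ (j,i) = U $$ (j,i) * of_real (d i)" if i: "i < n" for i
    proof -
      have "(U * D) $$ (j,i) = (\<Sum>k<n. U $$ (j,k) * D $$ (k,i))"
        by (rule index_mult_mat_sum[OF U D \<open>j < n\<close> i])
      also have "\<dots> = (\<Sum>k<n. if k = i then U $$ (j,i) * D $$ (i,i) else 0)"
        using off i by (intro sum.cong refl) auto
      also have "\<dots> = U $$ (j,i) * D $$ (i,i)" using i by simp
      also have "D $$ (i,i) = of_real (d i)" using im i by (simp add: d_def complex_eq_iff)
      finally show ?thesis .
    qed
    have "K (zs!j) (zs!l) = A $$ (j,l)" using that by (simp add: A_def)
    also have "\<dots> = (\<Sum>i<n. (U * D) $$ (j,i) * adjoint_mat U $$ (i,l))"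
      unfolding AU by (rule index_mult_mat_sum[OF mult_carrier_mat[OF U D] adjoint_mat_carrier[OF U] that])
    also have "\<dots> = (\<Sum>i<n. U $$ (j,i) * of_real (d i) * cnj (U $$ (l,i)))"
      by (intro sum.cong refl) (simp add: UD adjoint_mat_index[OF U] that)
    finally show ?thesis .
  qed
  have bij: "bij_betw (\<lambda>i. zs ! i) {..<n} (set zs)"
    using bij_betw_nth[of zs "{..<n}" "set zs"] dist by (simp add: n_def)
  define ix where "ix = the_inv_into {..<n} (\<lambda>i. zs ! i)"
  have ix: "ix (zs ! i) = i" if "i < n" for i
    unfolding ix_def using the_inv_into_f_f[of "\<lambda>i. zs ! i" "{..<n}"] bij that by (simp add: bij_betw_def)
  have sumB: "(\<Sum>z\<in>set zs. g z) = (\<Sum>i<n. g (zs ! i))" for g :: "'a \<Rightarrow> complex"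
    by (rule sum.reindex_bij_betw[OF bij, symmetric])
  define L where "L l c = (\<Sum>z\<in>set zs. U $$ (ix z, l) * c z)" for l c
  have form: "Re (herm_form K (set zs) c c) = (\<Sum>l<n. d l * (cmod (L l c))^2)" for c
  proof -
    have "herm_form K (set zs) c c = (\<Sum>j<n. \<Sum>p<n. \<Sum>l<n. of_real (d l) * ((U $$ (j,l) * c (zs!j)) * cnj (U $$ (p,l) * c (zs!p))))"
      unfolding herm_form_def sumB
      by (intro sum.cong refl) (simp add: entry sum_distrib_left sum_distrib_right mult_ac)
    also have "\<dots> = (\<Sum>j<n. \<Sum>l<n. \<Sum>p<n. of_real (d l) * ((U $$ (j,l) * c (zs!j)) * cnj (U $$ (p,l) * c (zs!p))))"
      by (intro sum.cong refl sum.swap)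
    also have "\<dots> = (\<Sum>l<n. \<Sum>j<n. \<Sum>p<n. of_real (d l) * ((U $$ (j,l) * c (zs!j)) * cnj (U $$ (p,l) * c (zs!p))))"
      by (rule sum.swap)
    also have "\<dots> = (\<Sum>l<n. of_real (d l) * (L l c * cnj (L l c)))"
      unfolding L_def sumB cnj_sum
      by (intro sum.cong refl) (simp add: ix sum_product, simp add: sum_distrib_left)
    also have "\<dots> = of_real (\<Sum>l<n. d l * (cmod (L l c))^2)"
      by (simp add: complex_norm_square del: of_real_power)
    finally show ?thesis by simp
  qed
  have "finite S" by (simp add: S_def)
  then obtain \<sigma> where \<sigma>: "bij_betw \<sigma> {0..<m} S" using ex_bij_betw_nat_finite[of S] by (auto simp: m_def)
  have \<sigma>S: "\<sigma> i \<in> S" if "i < m" for i using \<sigma> that by (auto simp: bij_betw_def)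
  have up: "\<not> has_negative_squares K (set zs) (Suc m)"
  proof (rule not_has_negative_squares_Suc[where l = "\<lambda>i z. U $$ (ix z, \<sigma> i)"])
    fix c assume c: "\<forall>i<m. (\<Sum>z\<in>set zs. U $$ (ix z, \<sigma> i) * c z) = 0"
    have "L l c = 0" if "l \<in> S" for l
    proof -
      have "l \<in> \<sigma> ` {0..<m}" using \<sigma> that by (simp add: bij_betw_def)
      then obtain i where "i < m" "l = \<sigma> i" by auto
      then show ?thesis using c by (simp add: L_def)
    qed
    then have "0 \<le> d l * (cmod (L l c))^2" if "l < n" for l
      using that by (cases "l \<in> S") (auto simp: S_def)
    then show "0 \<le> Re (herm_form K (set zs) c c)" unfolding form by (intro sum_nonneg) auto
  qed
  \<comment> \<open>The columns of \<open>U\<close> are conjugated because \<open>herm_form\<close>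
    acts on rows: with this choice \<open>L l (v i)\<close> is 1 for \<open>l = \<sigma> i\<close>
    and 0 otherwise.\<close>
  define v where "v i z = cnj (U $$ (ix z, \<sigma> i))" for i z
  have "negative_family K (set zs) m v"
    unfolding negative_family_def
  proof (intro allI impI)
    fix \<alpha> :: "nat \<Rightarrow> complex" assume "\<exists>i<m. \<alpha> i \<noteq> 0"
    then obtain i0 where i0: "i0 < m" "\<alpha> i0 \<noteq> 0" by blast
    let ?c = "\<lambda>z. \<Sum>i<m. \<alpha> i * v i z"
    have Lc: "L l ?c = (\<Sum>i<m. \<alpha> i * (if \<sigma> i = l then 1 else 0))" if l: "l < n" for l
    proof -
      have "L l ?c = (\<Sum>j<n. \<Sum>i<m. \<alpha> i * (cnj (U $$ (j, \<sigma> i)) * U $$ (j,l)))"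
        unfolding L_def sumB v_def by (intro sum.cong refl) (simp add: ix sum_distrib_left mult_ac)
      also have "\<dots> = (\<Sum>i<m. \<alpha> i * (\<Sum>j<n. cnj (U $$ (j, \<sigma> i)) * U $$ (j,l)))"
        by (subst sum.swap) (simp only: sum_distrib_left)
      also have "\<dots> = (\<Sum>i<m. \<alpha> i * (if \<sigma> i = l then 1 else 0))"
        by (intro sum.cong refl, subst orth) (use \<sigma>S l in \<open>auto simp: S_def\<close>)
      finally show ?thesis .
    qed
    have s0: "\<sigma> i0 \<in> S" using \<sigma>S i0 by blast
    have "L (\<sigma> i0) ?c = (\<Sum>i<m. if i = i0 then \<alpha> i0 else 0)"
    proof -
      have eq: "\<sigma> i = \<sigma> i0 \<longleftrightarrow> i = i0" if "i < m" for i
        using \<sigma> that i0(1) inj_on_eq_iff[of \<sigma> "{0..<m}" i i0] by (simp add: bij_betw_def)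
      have "L (\<sigma> i0) ?c = (\<Sum>i<m. \<alpha> i * (if \<sigma> i = \<sigma> i0 then 1 else 0))"
        by (rule Lc) (use s0 in \<open>simp add: S_def\<close>)
      also have "\<dots> = (\<Sum>i<m. if i = i0 then \<alpha> i0 else 0)"
        by (intro sum.cong refl) (use eq in auto)
      finally show ?thesis .
    qed
    then have L0: "L (\<sigma> i0) ?c = \<alpha> i0" using i0 by simp
    have "(\<Sum>l<n. d l * (cmod (L l ?c))^2) < (\<Sum>l<n. 0)"
    proof (rule sum_strict_mono_ex1)
      show "\<forall>l\<in>{..<n}. d l * (cmod (L l ?c))^2 \<le> 0"
      proof
        fix l assume l: "l \<in> {..<n}"
        show "d l * (cmod (L l ?c))^2 \<le> 0"
        proof (cases "l \<in> S")
          case True then show ?thesis by (auto simp: S_def mult_le_0_iff)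
        next
          case False
          then have "L l ?c = 0" using l \<sigma>S by (subst Lc) (auto intro!: sum.neutral)
          then show ?thesis by simp
        qed
      qed
      show "\<exists>l\<in>{..<n}. d l * (cmod (L l ?c))^2 < 0"
        using s0 i0(2) L0 by (intro bexI[of _ "\<sigma> i0"]) (auto simp: S_def mult_less_0_iff)
    qed simp
    then show "Re (herm_form K (set zs) ?c ?c) < 0" unfolding form by simp
  qed
  then have low: "has_negative_squares K (set zs) m" by (auto simp: has_negative_squares_def)
  have "has_negative_squares K (set zs) k \<longleftrightarrow> k \<le> m"
    using low up has_negative_squares_le by (metis not_less_eq_eq)
  then show ?thesis using sq by (simp add: A_def n_def)
qed

definition pick_kernel :: "(complex \<Rightarrow> complex) \<Rightarrow> complex \<Rightarrow> complex \<Rightarrow> complex" where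
  "pick_kernel f z w = (1 - f z * cnj (f w)) / (1 - z * cnj w)"

lemma hermitian_pick_kernel: "hermitian_on (pick_kernel f) A"
  by (simp add: hermitian_on_def pick_kernel_def mult.commute)

lemma has_negative_squares_pick_iff:
  "distinct zs \<Longrightarrow> has_negative_squares (pick_kernel f) (set zs) k \<longleftrightarrow> k \<le> sq_minus (pick_matrix f zs)"
  using has_negative_squares_iff_sq_minus[OF _ hermitian_pick_kernel, of zs f k]
  by (simp add: pick_matrix_def pick_kernel_def)

section \<open>Positivity of the Pick kernel of a Schur function\<close>

lemma unit_disk_eq_ball: "unit_disk = ball 0 1"
  by (auto simp: unit_disk_def)

lemma one_minus_mult_cnj_nonzero:
  assumes "cmod z < 1" "cmod w < 1"
  shows "1 - z * cnj w \<noteq> 0"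
proof
  assume "1 - z * cnj w = 0"
  then have "cmod z * cmod w = 1" by (metis complex_mod_cnj eq_iff_diff_eq_0 norm_mult norm_one)
  moreover have "cmod z * cmod w < 1 * 1" using assms by (intro mult_strict_mono') auto
  ultimately show False by simp
qed

text \<open>The factor \<open>1 - z * cnj w\<close> splits off; this is what makes the first summand
  of the Schur step a kernel of rank one.\<close>

lemma one_minus_blaschke:
  assumes "cmod p < 1" "cmod z < 1" "cmod w < 1"
  shows "1 - ((z - p) / (1 - cnj p * z)) * cnj ((w - p) / (1 - cnj p * w)) =
    (1 - p * cnj p) * (1 - z * cnj w) / ((1 - cnj p * z) * cnj (1 - cnj p * w))"
proof -
  have "1 - cnj p * z \<noteq> 0" "cnj (1 - cnj p * w) \<noteq> 0"
    using one_minus_mult_cnj_nonzero[of z p] one_minus_mult_cnj_nonzero[of w p] assms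
    by (auto simp: mult.commute simp del: complex_cnj_diff)
  then show ?thesis
    by (simp add: divide_simps) (simp add: algebra_simps)
qed

text \<open>One step of the Schur algorithm: \<open>K\<^sub>g = d d\<^sup>* (1 - \<beta> \<beta>\<^sup>*) / (1 - z w\<^sup>*) + (d \<beta>) (d \<beta>)\<^sup>* K\<^sub>h\<close> with
  \<open>h = (g - g\<^sub>0) / ((1 - cnj g\<^sub>0 g) \<beta>)\<close>, where the first summand has rank one.\<close>

lemma pick_kernel_schur_step:
  assumes p: "cmod p < 1" and gp: "cmod g0 < 1"
    and zw: "cmod z < 1" "cmod w < 1"
    and gz: "1 - cnj g0 * g z \<noteq> 0" and gw: "1 - cnj g0 * g w \<noteq> 0"
    and hz: "(g z - g0) / (1 - cnj g0 * g z) = (z - p) / (1 - cnj p * z) * h z"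
    and hw: "(g w - g0) / (1 - cnj g0 * g w) = (w - p) / (1 - cnj p * w) * h w"
  defines "s \<equiv> \<lambda>z. (1 - cnj g0 * g z) / (1 - cnj p * z)"
  shows "pick_kernel g z w * (1 - g0 * cnj g0) = (1 - p * cnj p) * (s z * cnj (s w))
     + (s z * (z - p)) * cnj (s w * (w - p)) * pick_kernel h z w"
proof -
  define \<beta> where "\<beta> z = (z - p) / (1 - cnj p * z)" for z
  let ?d = "\<lambda>z. 1 - cnj g0 * g z"
  let ?m = "\<lambda>z. (g z - g0) / ?d z"
  have nz: "1 - z * cnj w \<noteq> 0" "1 - cnj p * z \<noteq> 0" "1 - cnj p * w \<noteq> 0"
    using one_minus_mult_cnj_nonzero[of z w] one_minus_mult_cnj_nonzero[of z p] one_minus_mult_cnj_nonzero[of w p] zw p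
    by (auto simp: mult.commute)
  have nzw: "cnj (1 - cnj p * w) \<noteq> 0" "cnj (?d w) \<noteq> 0" using nz gw by (auto simp del: complex_cnj_diff)
  have A: "1 - ?m z * cnj (?m w) = (1 - g0 * cnj g0) * (1 - g z * cnj (g w)) / (?d z * cnj (?d w))"
    using gz nzw(2) by (simp add: divide_simps) (simp add: algebra_simps)
  have B: "1 - \<beta> z * cnj (\<beta> w) = (1 - p * cnj p) * (1 - z * cnj w) / ((1 - cnj p * z) * cnj (1 - cnj p * w))"
    unfolding \<beta>_def by (rule one_minus_blaschke[OF p zw])
  have "pick_kernel g z w * (1 - g0 * cnj g0) = ?d z * cnj (?d w) * (1 - ?m z * cnj (?m w)) / (1 - z * cnj w)"
    unfolding A pick_kernel_def using gz nzw(2) by simp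
  also have "1 - ?m z * cnj (?m w) = (1 - \<beta> z * cnj (\<beta> w)) + \<beta> z * cnj (\<beta> w) * (1 - h z * cnj (h w))"
    unfolding hz hw \<beta>_def[symmetric] by (simp add: algebra_simps)
  also have "?d z * cnj (?d w) * \<dots> / (1 - z * cnj w) =
      ?d z * cnj (?d w) * (1 - \<beta> z * cnj (\<beta> w)) / (1 - z * cnj w)
      + ?d z * cnj (?d w) * (\<beta> z * cnj (\<beta> w)) * pick_kernel h z w"
  proof -
    have "D * (X + Y * Z) / q = D * X / q + D * Y * (Z / q)" for D X Y Z q :: complex
      by (simp add: ring_distribs add_divide_distrib)
    then show ?thesis unfolding pick_kernel_def .
  qed
  also have "?d z * cnj (?d w) * (1 - \<beta> z * cnj (\<beta> w)) / (1 - z * cnj w) = (1 - p * cnj p) * (s z * cnj (s w))"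
    unfolding B s_def using nz by simp
  also have "?d z * cnj (?d w) * (\<beta> z * cnj (\<beta> w)) = (s z * (z - p)) * cnj (s w * (w - p))"
    unfolding s_def \<beta>_def by simp
  finally show ?thesis .
qed

text \<open>Turns the Schur step into an identity of quadratic forms with a square as first term.
  The square is nonnegative, which carries positivity from \<open>H\<close> to \<open>K\<close>;
  choosing \<open>c\<close> so that it vanishes carries positivity from \<open>K\<close> to
  \<open>H\<close>.\<close>

lemma herm_form_split:
  assumes "\<And>z w. z \<in> A \<Longrightarrow> w \<in> A \<Longrightarrow> K z w * of_real \<gamma> = of_real \<delta> * (s z * cnj (s w)) + t z * cnj (t w) * H z w"
  shows "\<gamma> * Re (herm_form K A c c) = \<delta> * (cmod (\<Sum>z\<in>A. c z * s z))^2 + Re (herm_form H A (\<lambda>z. c z * t z) (\<lambda>z. c z * t z))"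
proof -
  have "of_real \<gamma> * herm_form K A c c = (\<Sum>z\<in>A. \<Sum>w\<in>A. c z * (K z w * of_real \<gamma>) * cnj (c w))"
    unfolding herm_form_def sum_distrib_left by (intro sum.cong refl) (simp add: mult_ac)
  also have "\<dots> = (\<Sum>z\<in>A. \<Sum>w\<in>A. of_real \<delta> * ((c z * s z) * cnj (c w * s w)) + (c z * t z) * H z w * cnj (c w * t w))"
  proof (intro sum.cong refl)
    fix z w assume zw: "z \<in> A" "w \<in> A"
    show "c z * (K z w * of_real \<gamma>) * cnj (c w) =
        of_real \<delta> * ((c z * s z) * cnj (c w * s w)) + (c z * t z) * H z w * cnj (c w * t w)"
      unfolding assms[OF zw] by (simp add: algebra_simps)
  qed
  also have "\<dots> = of_real \<delta> * ((\<Sum>z\<in>A. c z * s z) * cnj (\<Sum>z\<in>A. c z * s z)) + herm_form H A (\<lambda>z. c z * t z) (\<lambda>z. c z * t z)"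
    unfolding herm_form_def cnj_sum sum_product by (simp add: sum.distrib sum_distrib_left)
  also have "\<dots> = of_real (\<delta> * (cmod (\<Sum>z\<in>A. c z * s z))^2) + herm_form H A (\<lambda>z. c z * t z) (\<lambda>z. c z * t z)"
    by (simp add: complex_norm_square del: of_real_power)
  finally show ?thesis by (auto dest!: arg_cong[where f = Re])
qed

lemma one_minus_cnj_mult_nonzero:
  assumes "cmod p < 1" "cmod z \<le> 1"
  shows "1 - cnj p * z \<noteq> 0"
proof
  assume "1 - cnj p * z = 0"
  then have "cmod p * cmod z = 1" by (metis complex_mod_cnj eq_iff_diff_eq_0 norm_mult norm_one)
  moreover have "cmod p * cmod z \<le> cmod p * 1" using assms by (intro mult_left_mono) auto
  ultimately show False using assms by simp
qed

lemma norm_blaschke_less_1: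
  assumes "cmod p < 1" "cmod z < 1"
  shows "cmod ((z - p) / (1 - cnj p * z)) < 1"
proof -
  let ?b = "(z - p) / (1 - cnj p * z)"
  have "complex_of_real (1 - (cmod ?b)^2) = 1 - ?b * cnj ?b"
    by (simp add: complex_norm_square del: of_real_power)
  also have "\<dots> = (1 - p * cnj p) * (1 - z * cnj z) / ((1 - cnj p * z) * cnj (1 - cnj p * z))"
    by (rule one_minus_blaschke[OF assms(1,2,2)])
  also have "\<dots> = of_real ((1 - (cmod p)^2) * (1 - (cmod z)^2) / (cmod (1 - cnj p * z))^2)"
    by (simp add: complex_norm_square del: of_real_power complex_cnj_diff)
  finally have "1 - (cmod ?b)^2 = (1 - (cmod p)^2) * (1 - (cmod z)^2) / (cmod (1 - cnj p * z))^2"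
    using of_real_eq_iff by blast
  also have "\<dots> > 0"
    using assms one_minus_cnj_mult_nonzero[of p z] by (intro divide_pos_pos mult_pos_pos) (auto simp: abs_square_less_1)
  finally show ?thesis by (simp add: abs_square_less_1)
qed

text \<open>This is the Schwarz lemma transported: \<open>\<phi>\<close> moves 0 to \<open>p\<close>
  and the outer map in \<open>m\<close> moves \<open>g p\<close> to 0, so \<open>F\<close> fixes 0
  and is \<open>z\<close> times a holomorphic \<open>H\<close> bounded by 1, where at 0 the bound is
  the one on the derivative. Composing with \<open>\<beta>\<close>, which \<open>\<phi>\<close>
  inverts, brings \<open>H\<close> back to \<open>p\<close>.\<close>

lemma schur_quotient:
  assumes g: "g holomorphic_on ball 0 1" "\<And>z. z \<in> ball 0 1 \<Longrightarrow> cmod (g z) \<le> 1"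
    and p: "p \<in> ball 0 1" "cmod (g p) < 1"
  obtains h where "h holomorphic_on ball 0 1" "\<And>z. z \<in> ball 0 1 \<Longrightarrow> cmod (h z) \<le> 1"
    "\<And>z. z \<in> ball 0 1 \<Longrightarrow> (g z - g p) / (1 - cnj (g p) * g z) = (z - p) / (1 - cnj p * z) * h z"
proof -
  have p1: "cmod p < 1" using p by simp
  \<comment> \<open>The Schwarz lemma asks for strict bounds; the maximum principle supplies them,
    since \<open>g\<close> is not a unimodular constant.\<close>
  have g1: "cmod (g z) < 1" if z: "z \<in> ball 0 1" for z
  proof (rule ccontr)
    assume "\<not> cmod (g z) < 1"
    then have eq: "cmod (g z) = 1" using g(2)[OF z] by simp
    have "g constant_on ball 0 1"
      by (rule maximum_modulus_principle[OF g(1) open_ball connected_ball open_ball subset_refl z])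
        (use g(2) eq in auto)
    then have "g z = g p" using z p by (metis constant_on_def)
    then show False using eq p by simp
  qed
  define \<beta> where "\<beta> z = (z - p) / (1 - cnj p * z)" for z
  define \<phi> where "\<phi> z = (z + p) / (1 + cnj p * z)" for z
  have \<beta>: "cmod (\<beta> z) < 1" if "z \<in> ball 0 1" for z
    unfolding \<beta>_def using norm_blaschke_less_1[OF p1] that by simp
  have \<phi>: "cmod (\<phi> z) < 1" if "z \<in> ball 0 1" for z
    unfolding \<phi>_def using norm_blaschke_less_1[of "-p" z] p1 that by simp
  have nz: "1 - cnj p * z \<noteq> 0" "1 + cnj p * z \<noteq> 0" if "z \<in> ball 0 1" for z
    using one_minus_cnj_mult_nonzero[of p z] one_minus_cnj_mult_nonzero[of "-p" z] p1 that by auto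
  have hol: "\<beta> holomorphic_on ball 0 1" "\<phi> holomorphic_on ball 0 1"
    unfolding \<beta>_def \<phi>_def by (intro holomorphic_intros; use nz in blast)+
  have \<phi>\<beta>: "\<phi> (\<beta> z) = z" if z: "z \<in> ball 0 1" for z
  proof -
    have q: "1 - cnj p * p \<noteq> 0" using nz(1)[OF p(1)] .
    have "\<beta> z + p = z * (1 - cnj p * p) / (1 - cnj p * z)"
      unfolding \<beta>_def using nz[OF z] by (simp add: divide_simps) (simp add: algebra_simps)
    moreover have "1 + cnj p * \<beta> z = (1 - cnj p * p) / (1 - cnj p * z)"
      unfolding \<beta>_def using nz[OF z] by (simp add: divide_simps) (simp add: algebra_simps)
    ultimately show ?thesis unfolding \<phi>_def[of "\<beta> z"] using nz[OF z] q by simp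
  qed
  define m where "m z = (g z - g p) / (1 - cnj (g p) * g z)" for z
  have mhol: "m holomorphic_on ball 0 1"
    unfolding m_def by (intro holomorphic_intros g(1)) (use one_minus_cnj_mult_nonzero p(2) g(2) in blast)
  have m1: "cmod (m z) < 1" if "z \<in> ball 0 1" for z
    unfolding m_def using norm_blaschke_less_1[OF p(2) g1[OF that]] .
  define F where "F = m \<circ> \<phi>"
  have Fhol: "F holomorphic_on ball 0 1"
    unfolding F_def by (rule holomorphic_on_compose_gen[OF hol(2) mhol]) (use \<phi> in auto)
  have F0: "F 0 = 0" by (simp add: F_def \<phi>_def m_def)
  have F1: "cmod (F z) < 1" if "cmod z < 1" for z
    unfolding F_def comp_def using m1 \<phi>[of z] that by simp
  obtain H where H: "H holomorphic_on ball 0 1" "\<And>z. cmod z < 1 \<Longrightarrow> F z = z * H z" "deriv F 0 = H 0"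
    using Schwarz3[OF Fhol F0] by blast
  have H1: "cmod (H z) \<le> 1" if z: "cmod z < 1" for z
  proof (cases "z = 0")
    case True
    then show ?thesis using Schwarz_Lemma(2)[OF Fhol F0 F1 z] H(3) by simp
  next
    case False
    have "cmod z * cmod (H z) \<le> cmod z * 1"
      using Schwarz_Lemma(1)[OF Fhol F0 F1 z] H(2)[OF z] by (simp add: norm_mult)
    then show ?thesis using False by simp
  qed
  show ?thesis
  proof (rule that[of "H \<circ> \<beta>"])
    show "H \<circ> \<beta> holomorphic_on ball 0 1"
      by (rule holomorphic_on_compose_gen[OF hol(1) H(1)]) (use \<beta> in auto)
    show "cmod ((H \<circ> \<beta>) z) \<le> 1" if "z \<in> ball 0 1" for z using H1 \<beta>[OF that] by simp
    show "(g z - g p) / (1 - cnj (g p) * g z) = (z - p) / (1 - cnj p * z) * (H \<circ> \<beta>) z" if "z \<in> ball 0 1" for z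
      using H(2)[OF \<beta>[OF that]] \<phi>\<beta>[OF that] unfolding F_def m_def \<beta>_def comp_def by simp
  qed
qed

text \<open>Induction on the number of points by the Schur algorithm: the weight
  \<open>s z * (z - p)\<close> vanishes at \<open>p\<close>, so after splitting off a square the
  form of the next Schur function lives on one point fewer. If \<open>g p\<close> is unimodular,
  \<open>g\<close> is constant and the kernel is zero.\<close>

lemma psd_on_pick_kernel_schur:
  assumes "finite A" "A \<subseteq> ball 0 1" "g holomorphic_on ball 0 1" "\<And>z. z \<in> ball 0 1 \<Longrightarrow> cmod (g z) \<le> 1"
  shows "psd_on (pick_kernel g) A"
  using assms
proof (induction A arbitrary: g rule: finite_induct)
  case empty
  then show ?case by (simp add: psd_on_def herm_form_def)
next
  case (insert p A)
  note g = insert.prems(2,3)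
  have p: "p \<in> ball 0 1" using insert.prems by simp
  show ?case
  proof (cases "cmod (g p) = 1")
    case True
    have "g constant_on ball 0 1"
      by (rule maximum_modulus_principle[OF g(1) open_ball connected_ball open_ball subset_refl p])
        (use g(2) True in auto)
    then obtain k where k: "\<And>z. z \<in> ball 0 1 \<Longrightarrow> g z = k" by (auto simp: constant_on_def)
    have "k * cnj k = 1" using k[OF p] True by (metis complex_norm_square of_real_1 power_one)
    then have "pick_kernel g z w = 0" if "z \<in> insert p A" "w \<in> insert p A" for z w
      using k that insert.prems(1) by (auto simp: pick_kernel_def subset_iff)
    then have "herm_form (pick_kernel g) (insert p A) c c = 0" for c
      unfolding herm_form_def by (intro sum.neutral ballI) simp
    then show ?thesis by (simp add: psd_on_def)
  next
    case False
    then have gp: "cmod (g p) < 1" using g(2)[OF p] by simp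
    obtain h where h: "h holomorphic_on ball 0 1" "\<And>z. z \<in> ball 0 1 \<Longrightarrow> cmod (h z) \<le> 1"
      and hg: "\<And>z. z \<in> ball 0 1 \<Longrightarrow> (g z - g p) / (1 - cnj (g p) * g z) = (z - p) / (1 - cnj p * z) * h z"
      using schur_quotient[OF g p gp] by blast
    have IH: "psd_on (pick_kernel h) A" using insert.IH[OF _ h] insert.prems(1) by auto
    define s where "s z = (1 - cnj (g p) * g z) / (1 - cnj p * z)" for z
    have d: "1 - cnj (g p) * g z \<noteq> 0" if "z \<in> ball 0 1" for z
    proof
      assume "1 - cnj (g p) * g z = 0"
      then have "cmod (g p) * cmod (g z) = 1" by (metis complex_mod_cnj eq_iff_diff_eq_0 norm_mult norm_one)
      moreover have "cmod (g p) * cmod (g z) \<le> cmod (g p) * 1" using g(2)[OF that] by (intro mult_left_mono) auto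
      ultimately show False using gp by simp
    qed
    have of1: "1 - x * cnj x = of_real (1 - (cmod x)^2)" for x
      by (simp add: complex_norm_square del: of_real_power)
    have step: "pick_kernel g z w * of_real (1 - (cmod (g p))^2) =
       of_real (1 - (cmod p)^2) * (s z * cnj (s w)) + (s z * (z - p)) * cnj (s w * (w - p)) * pick_kernel h z w"
      if "z \<in> insert p A" "w \<in> insert p A" for z w
    proof -
      have zw: "z \<in> ball 0 1" "w \<in> ball 0 1" using that insert.prems(1) by auto
      show ?thesis
        unfolding of1[symmetric] s_def
        by (rule pick_kernel_schur_step) (use p gp zw d hg in auto)
    qed
    have "0 \<le> Re (herm_form (pick_kernel g) (insert p A) c c)" for c
    proof -
      let ?t = "\<lambda>z. c z * (s z * (z - p))"
      have "(1 - (cmod (g p))^2) * Re (herm_form (pick_kernel g) (insert p A) c c) =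
        (1 - (cmod p)^2) * (cmod (\<Sum>z\<in>insert p A. c z * s z))^2 + Re (herm_form (pick_kernel h) (insert p A) ?t ?t)"
        by (rule herm_form_split[OF step])
      also have "herm_form (pick_kernel h) (insert p A) ?t ?t = herm_form (pick_kernel h) A ?t ?t"
        by (rule herm_form_restrict) (use insert.hyps in auto)
      also have "(1 - (cmod p)^2) * (cmod (\<Sum>z\<in>insert p A. c z * s z))^2 + Re \<dots> \<ge> 0"
        using IH p by (auto simp: psd_on_def power_le_one intro!: add_nonneg_nonneg mult_nonneg_nonneg)
      finally have "0 \<le> (1 - (cmod (g p))^2) * Re (herm_form (pick_kernel g) (insert p A) c c)" .
      moreover have "1 - (cmod (g p))^2 > 0" using gp by (simp add: power_less_one_iff abs_square_less_1)
      ultimately show ?thesis by (simp add: zero_le_mult_iff)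
    qed
    then show ?thesis by (simp add: psd_on_def)
  qed
qed

section \<open>Consequences of positivity on one and two points\<close>

lemma psd_on_subset:
  fixes K :: "'a \<Rightarrow> 'a \<Rightarrow> complex"
  assumes "psd_on K A" "B \<subseteq> A" "finite A"
  shows "psd_on K B"
  unfolding psd_on_def
proof
  fix c :: "'a \<Rightarrow> complex"
  let ?c = "\<lambda>z. if z \<in> B then c z else 0"
  have "herm_form K B c c = herm_form K B ?c ?c" by (rule herm_form_cong) auto
  also have "\<dots> = herm_form K A ?c ?c" by (rule herm_form_restrict[OF assms(3,2), symmetric]) auto
  finally show "0 \<le> Re (herm_form K B c c)" using assms(1) by (simp add: psd_on_def)
qed

lemma psd_on_diagonal:
  assumes "psd_on K {z}"
  shows "0 \<le> Re (K z z)"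
  using assms[unfolded psd_on_def, rule_format, of "\<lambda>_. 1"] by (simp add: herm_form_def)

lemma psd_on_cauchy_schwarz:
  assumes psd: "psd_on K {z,w}" and h: "hermitian_on K {z,w}" and "z \<noteq> w"
  shows "(cmod (K z w))^2 \<le> Re (K z z) * Re (K w w)"
proof -
  define b where "b = K z w"
  have Kwz: "K w z = cnj b" using h unfolding hermitian_on_def b_def by blast
  have form: "0 \<le> t^2 * Re (K z z) * (cmod b)^2 - 2 * t * (cmod b)^2 + Re (K w w)" for t :: real
  proof -
    \<comment> \<open>The phase is aligned with \<open>b\<close>, so that the form becomes a real
      polynomial in \<open>t\<close>; its minimiser \<open>1 / Re (K z z)\<close> gives the
      inequality when the diagonal entry is positive.\<close>
    let ?c = "\<lambda>x. if x = z then of_real (-t) * cnj b else 1"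
    have "herm_form K {z,w} ?c ?c = of_real (t^2) * K z z * (cnj b * b) - of_real (2*t) * (cnj b * b) + K w w"
      using \<open>z \<noteq> w\<close> by (simp add: herm_form_def Kwz b_def[symmetric] power2_eq_square algebra_simps)
    also have "cnj b * b = of_real ((cmod b)^2)" by (metis complex_norm_square mult.commute)
    finally have "Re (herm_form K {z,w} ?c ?c) = t^2 * Re (K z z) * (cmod b)^2 - 2 * t * (cmod b)^2 + Re (K w w)"
      by simp
    then show ?thesis using psd unfolding psd_on_def by metis
  qed
  have a0: "0 \<le> Re (K z z)" by (rule psd_on_diagonal, rule psd_on_subset[OF psd]) auto
  show ?thesis
  proof (cases "Re (K z z) = 0")
    case True
    have "(cmod b)^2 = 0"
    proof (rule ccontr)
      assume ne: "(cmod b)^2 \<noteq> 0"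
      \<comment> \<open>With \<open>K z z\<close> zero the form is affine in \<open>t\<close>, and
        at this \<open>t\<close> it equals -1.\<close>
      show False using form[of "(Re (K w w) + 1) / (2 * (cmod b)^2)"] True ne by (simp add: field_simps)
    qed
    then show ?thesis using True by (simp add: b_def)
  next
    case False
    then have a: "Re (K z z) > 0" using a0 by simp
    have "0 \<le> (cmod b)^2 / Re (K z z) - 2 * ((cmod b)^2 / Re (K z z)) + Re (K w w)"
      using form[of "1 / Re (K z z)"] a by (simp add: power2_eq_square field_simps)
    then show ?thesis using a by (simp add: field_simps b_def)
  qed
qed

lemma pick_kernel_diagonal: "Re (pick_kernel g z z) = (1 - (cmod (g z))^2) / (1 - (cmod z)^2)"
proof -
  have "pick_kernel g z z = of_real ((1 - (cmod (g z))^2) / (1 - (cmod z)^2))"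
    by (simp add: pick_kernel_def complex_norm_square del: of_real_power)
  then show ?thesis by simp
qed

lemma psd_on_pick_norm_le_1:
  assumes "psd_on (pick_kernel g) {z}" "cmod z < 1"
  shows "cmod (g z) \<le> 1"
proof -
  have "0 \<le> (1 - (cmod (g z))^2) / (1 - (cmod z)^2)"
    using psd_on_diagonal[OF assms(1)] by (simp add: pick_kernel_diagonal)
  moreover have "1 - (cmod z)^2 > 0" using assms(2) by (simp add: abs_square_less_1)
  ultimately have "(cmod (g z))^2 \<le> 1" by (simp add: zero_le_divide_iff)
  then show ?thesis by (simp add: abs_square_le_1)
qed

text \<open>Used once for the points and once for the values of \<open>g\<close>: the product terms
  then cancel from the determinant inequality and only the differences remain.\<close>

lemma norm_one_minus_mult_cnj:
  "(cmod (1 - u * cnj v))^2 = (cmod (u - v))^2 + (1 - (cmod u)^2) * (1 - (cmod v)^2)"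
  by (simp add: cmod_power2) (simp add: power2_eq_square algebra_simps)

text \<open>The Schwarz-Pick inequality with denominators cleared, so that it also covers unimodular
  values, where it forces \<open>g z = g w\<close>.\<close>

lemma psd_on_pick_two_points:
  assumes psd: "psd_on (pick_kernel g) {z,w}" and z: "cmod z < 1" "cmod w < 1"
  shows "(1 - (cmod z)^2) * (1 - (cmod w)^2) * (cmod (g z - g w))^2 \<le> (1 - (cmod (g z))^2) * (1 - (cmod (g w))^2) * (cmod (z - w))^2"
proof (cases "z = w")
  case False
  define P where "P = (1 - (cmod (g z))^2) * (1 - (cmod (g w))^2)"
  define q where "q = (1 - (cmod z)^2) * (1 - (cmod w)^2)"
  have q: "q > 0" unfolding q_def using z by (simp add: abs_square_less_1)
  have n: "cmod (1 - z * cnj w) > 0" using one_minus_mult_cnj_nonzero[OF z] by simp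
  have "(cmod (1 - g z * cnj (g w)))^2 / (cmod (1 - z * cnj w))^2 \<le> P / q"
    using psd_on_cauchy_schwarz[OF psd hermitian_pick_kernel False]
    unfolding pick_kernel_diagonal P_def q_def by (simp add: pick_kernel_def norm_divide power_divide)
  then have "(cmod (1 - g z * cnj (g w)))^2 * q \<le> P * (cmod (1 - z * cnj w))^2"
    using q n by (simp add: divide_simps)
  then have "q * (cmod (g z - g w))^2 \<le> P * (cmod (z - w))^2"
    unfolding norm_one_minus_mult_cnj[of "g z"] norm_one_minus_mult_cnj[of z] P_def[symmetric] q_def[symmetric]
    by (simp add: algebra_simps)
  then show ?thesis unfolding P_def q_def .
qed simp

lemma psd_on_pick_lipschitz:
  assumes psd: "psd_on (pick_kernel g) {z,w}" and z: "cmod z \<le> \<rho>" "cmod w \<le> \<rho>" and \<rho>: "\<rho> < 1"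
  shows "cmod (g z - g w) \<le> cmod (z - w) / (1 - \<rho>^2)"
proof -
  have \<rho>0: "0 \<le> \<rho>" using z norm_ge_zero order_trans by blast
  have z1: "cmod z < 1" "cmod w < 1" using z \<rho> by auto
  have q: "1 - \<rho>^2 > 0" using \<rho> \<rho>0 by (simp add: abs_square_less_1)
  have gz: "cmod (g z) \<le> 1" "cmod (g w) \<le> 1"
    by (rule psd_on_pick_norm_le_1, rule psd_on_subset[OF psd], use z1 in auto)+
  have "(1 - \<rho>^2) * (1 - \<rho>^2) \<le> (1 - (cmod z)^2) * (1 - (cmod w)^2)"
    using z q power_mono[OF z(1), of 2] power_mono[OF z(2), of 2] by (intro mult_mono) auto
  then have "(1 - \<rho>^2)^2 * (cmod (g z - g w))^2 \<le> (1 - (cmod z)^2) * (1 - (cmod w)^2) * (cmod (g z - g w))^2"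
    by (simp add: power2_eq_square mult_right_mono)
  also have "\<dots> \<le> (1 - (cmod (g z))^2) * (1 - (cmod (g w))^2) * (cmod (z - w))^2"
    by (rule psd_on_pick_two_points[OF psd z1])
  also have "\<dots> \<le> 1 * 1 * (cmod (z - w))^2"
    using gz by (intro mult_right_mono mult_mono) (auto simp: power_le_one)
  finally have "((1 - \<rho>^2) * cmod (g z - g w))^2 \<le> (cmod (z - w))^2" by (simp add: power_mult_distrib)
  then have "(1 - \<rho>^2) * cmod (g z - g w) \<le> cmod (z - w)" by (rule power2_le_imp_le) simp
  then show ?thesis using q by (simp add: field_simps)
qed

section \<open>Hindmarsh's theorem\<close>

text \<open>The Schur step read backwards. One of the three points is spent: the coefficient at
  \<open>p\<close> is free, because the weight of the second summand vanishes there, and can be used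
  to cancel the rank one term.\<close>

lemma psd_on_schur_quotient:
  assumes psd: "psd_on (pick_kernel g) {p,z,w}"
    and d: "cmod p < 1" "cmod z < 1" "cmod w < 1" and ne: "z \<noteq> p" "w \<noteq> p" and gp: "cmod (g p) < 1"
  shows "psd_on (pick_kernel (\<lambda>z. (g z - g p) / (1 - cnj (g p) * g z) / ((z - p) / (1 - cnj p * z)))) {z,w}"
proof -
  define h where "h z = (g z - g p) / (1 - cnj (g p) * g z) / ((z - p) / (1 - cnj p * z))" for z
  define s where "s z = (1 - cnj (g p) * g z) / (1 - cnj p * z)" for z
  have g1: "cmod (g x) \<le> 1" if "x \<in> {p,z,w}" for x
    by (rule psd_on_pick_norm_le_1, rule psd_on_subset[OF psd]) (use that d in auto)
  have x1: "cmod x < 1" if "x \<in> {p,z,w}" for x using that d by auto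
  have dg: "1 - cnj (g p) * g x \<noteq> 0" if "x \<in> {p,z,w}" for x
    by (rule one_minus_cnj_mult_nonzero[OF gp g1[OF that]])
  have dp: "1 - cnj p * x \<noteq> 0" if "x \<in> {p,z,w}" for x
    by (rule one_minus_cnj_mult_nonzero[OF d(1)]) (use x1[OF that] in simp)
  have s0: "s x \<noteq> 0" if "x \<in> {p,z,w}" for x unfolding s_def using dg[OF that] dp[OF that] by simp
  \<comment> \<open>At \<open>x = p\<close> both sides are 0, whatever value division by zero
    assigns to \<open>h p\<close>.\<close>
  have hg: "(g x - g p) / (1 - cnj (g p) * g x) = (x - p) / (1 - cnj p * x) * h x" if "x \<in> {p,z,w}" for x
    unfolding h_def using dp[OF that] by (cases "x = p") simp_all
  have of1: "1 - x * cnj x = of_real (1 - (cmod x)^2)" for x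
    by (simp add: complex_norm_square del: of_real_power)
  have step: "pick_kernel g x y * of_real (1 - (cmod (g p))^2) =
     of_real (1 - (cmod p)^2) * (s x * cnj (s y)) + (s x * (x - p)) * cnj (s y * (y - p)) * pick_kernel h x y"
    if "x \<in> {p,z,w}" "y \<in> {p,z,w}" for x y
    unfolding of1[symmetric] s_def
    by (rule pick_kernel_schur_step[OF d(1) gp x1[OF that(1)] x1[OF that(2)] dg[OF that(1)] dg[OF that(2)] hg[OF that(1)] hg[OF that(2)]])
  have "0 \<le> Re (herm_form (pick_kernel h) {z,w} c c)" for c
  proof -
    define c0 where "c0 x = c x / (s x * (x - p))" for x
    \<comment> \<open>The value at \<open>p\<close> is chosen so that the sum of
      \<open>c' x * s x\<close> is 0.\<close>
    define c' where "c' x = (if x = p then - (\<Sum>y\<in>{z,w}. c0 y * s y) / s p else c0 x)" for x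
    let ?t = "\<lambda>x. c' x * (s x * (x - p))"
    have "(\<Sum>x\<in>{p,z,w}. c' x * s x) = c' p * s p + (\<Sum>x\<in>{z,w}. c' x * s x)"
      using ne by (subst sum.insert) auto
    also have "(\<Sum>x\<in>{z,w}. c' x * s x) = (\<Sum>x\<in>{z,w}. c0 x * s x)"
      using ne by (intro sum.cong) (auto simp: c'_def)
    also have "c' p * s p = - (\<Sum>y\<in>{z,w}. c0 y * s y)" using s0[of p] by (simp add: c'_def)
    finally have S: "(\<Sum>x\<in>{p,z,w}. c' x * s x) = 0" by simp
    have "(1 - (cmod (g p))^2) * Re (herm_form (pick_kernel g) {p,z,w} c' c') =
        (1 - (cmod p)^2) * (cmod (\<Sum>z\<in>{p,z,w}. c' z * s z))^2 + Re (herm_form (pick_kernel h) {p,z,w} ?t ?t)"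
      by (rule herm_form_split[OF step])
    also have "\<dots> = Re (herm_form (pick_kernel h) {p,z,w} ?t ?t)" unfolding S by simp
    also have "herm_form (pick_kernel h) {p,z,w} ?t ?t = herm_form (pick_kernel h) {z,w} ?t ?t"
      by (rule herm_form_restrict) auto
    also have "\<dots> = herm_form (pick_kernel h) {z,w} c c"
      using s0 ne by (intro herm_form_cong) (auto simp: c'_def c0_def)
    finally have "Re (herm_form (pick_kernel h) {z,w} c c) = (1 - (cmod (g p))^2) * Re (herm_form (pick_kernel g) {p,z,w} c' c')" by simp
    also have "\<dots> \<ge> 0"
      using psd gp by (auto simp: psd_on_def power_le_one intro!: mult_nonneg_nonneg)
    finally show ?thesis .
  qed
  then show ?thesis unfolding psd_on_def h_def by blast
qed

text \<open>One point is \<open>p\<close>; positivity with the other two passes to the quotient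
  \<open>h\<close>. The Lipschitz constant of \<open>h\<close> is uniform near \<open>p\<close>, so
  \<open>h\<close> has a limit at \<open>p\<close> although no continuity of \<open>g\<close> is
  assumed.\<close>

lemma pick_three_points_differentiable:
  assumes G: "open G" "G \<subseteq> ball 0 1"
    and psd: "\<And>x y z. {x,y,z} \<subseteq> G \<Longrightarrow> psd_on (pick_kernel g) {x,y,z}" and p: "p \<in> G"
  shows "g field_differentiable at p"
proof -
  have psd2: "psd_on (pick_kernel g) {x,y}" if "{x,y} \<subseteq> G" for x y using psd[of x y y] that by simp
  have g1: "cmod (g x) \<le> 1" if "x \<in> G" for x
    using psd_on_pick_norm_le_1[of g x] psd2[of x x] that G(2) by auto
  have p1: "cmod p < 1" using p G by auto
  show ?thesis
  proof (cases "cmod (g p) = 1")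
    case True
    \<comment> \<open>The right-hand side of Schwarz-Pick is 0 when \<open>g p\<close> is
      unimodular, so \<open>g\<close> is constant on \<open>G\<close>.\<close>
    have const: "g z = g p" if z: "z \<in> G" for z
    proof -
      have "(1 - (cmod z)^2) * (1 - (cmod p)^2) * (cmod (g z - g p))^2 \<le> 0"
        using psd_on_pick_two_points[OF psd2[of z p], OF _ _ p1] z p G(2) True by auto
      moreover have "(1 - (cmod z)^2) * (1 - (cmod p)^2) > 0"
        using z G(2) p1 by (intro mult_pos_pos) (auto simp: abs_square_less_1 subset_iff)
      ultimately have "(cmod (g z - g p))^2 \<le> 0" by (meson mult_pos_pos not_le)
      then show ?thesis by simp
    qed
    have "((\<lambda>_. g p) has_field_derivative 0) (at p)" by simp
    then have "(g has_field_derivative 0) (at p)"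
      by (rule has_field_derivative_transform_within_open[OF _ G(1) p]) (use const in auto)
    then show ?thesis by (auto simp: field_differentiable_def)
  next
    case False
    then have gp: "cmod (g p) < 1" using g1[OF p] by simp
    define m where "m z = (g z - g p) / (1 - cnj (g p) * g z)" for z
    define h where "h z = m z / ((z - p) / (1 - cnj p * z))" for z
    have psdh: "psd_on (pick_kernel h) {z,w}" if "z \<in> G - {p}" "w \<in> G - {p}" for z w
      unfolding h_def m_def
      by (rule psd_on_schur_quotient) (use psd[of p z w] that p G(2) gp in auto)
    obtain \<rho> where \<rho>: "cmod p < \<rho>" "\<rho> < 1" using dense[OF p1] by blast
    have "open (G \<inter> ball 0 \<rho>)" "p \<in> G \<inter> ball 0 \<rho>" using G p \<rho> by auto
    then obtain e where e: "e > 0" "ball p e \<subseteq> G \<inter> ball 0 \<rho>" using openE by metis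
    define X where "X = ball p e - {p}"
    have \<rho>0: "0 \<le> \<rho>" using \<rho>(1) norm_ge_zero[of p] by linarith
    have q: "1 - \<rho>^2 > 0" using \<rho> \<rho>0 by (simp add: abs_square_less_1)
    have lip: "cmod (h z - h w) \<le> cmod (z - w) / (1 - \<rho>^2)" if "z \<in> X" "w \<in> X" for z w
    proof (rule psd_on_pick_lipschitz[OF psdh _ _ \<rho>(2)])
      show "z \<in> G - {p}" "w \<in> G - {p}" using that e by (auto simp: X_def)
      have "z \<in> ball 0 \<rho>" "w \<in> ball 0 \<rho>" using that e by (auto simp: X_def)
      then show "cmod z \<le> \<rho>" "cmod w \<le> \<rho>" by auto
    qed
    have "uniformly_continuous_on X h"
      unfolding uniformly_continuous_on_def
    proof (intro allI impI)
      fix \<epsilon> :: real assume \<epsilon>: "\<epsilon> > 0"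
      show "\<exists>\<delta>>0. \<forall>x\<in>X. \<forall>x'\<in>X. dist x' x < \<delta> \<longrightarrow> dist (h x') (h x) < \<epsilon>"
      proof (intro exI[of _ "\<epsilon> * (1 - \<rho>^2)"] conjI ballI impI)
        fix x x' assume x: "x \<in> X" "x' \<in> X" "dist x' x < \<epsilon> * (1 - \<rho>^2)"
        have "dist (h x') (h x) \<le> dist x' x / (1 - \<rho>^2)" using lip[OF x(2,1)] by (simp add: dist_norm)
        also have "\<dots> < \<epsilon>" using x(3) q by (simp add: divide_less_eq)
        finally show "dist (h x') (h x) < \<epsilon>" .
      qed (use \<epsilon> q in simp)
    qed
    moreover have "p \<in> closure X"
    proof -
      have "p islimpt ball p e" using e by (intro interior_limit_point) auto
      then have "p islimpt X" unfolding X_def using islimpt_punctured by blast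
      then show ?thesis by (simp add: closure_def)
    qed
    ultimately obtain l where "(h \<longlongrightarrow> l) (at p within X)"
      using uniformly_continuous_on_extension_at_closure by blast
    moreover have "at p within X = at p"
    proof -
      have "at p within X = at p within ball p e" unfolding X_def at_within_def by simp
      also have "\<dots> = at p" using e(1) by (intro at_within_open) auto
      finally show ?thesis .
    qed
    ultimately have hl: "(h \<longlongrightarrow> l) (at p)" by simp
    have dp: "1 - cnj p * p \<noteq> 0" by (rule one_minus_cnj_mult_nonzero) (use p1 in auto)
    have "((\<lambda>z. h z / (1 - cnj p * z)) \<longlongrightarrow> l / (1 - cnj p * p)) (at p)"
      by (intro tendsto_intros hl dp)
    \<comment> \<open>Since \<open>m p = 0\<close>, this is the difference quotient of
      \<open>m\<close> at \<open>p\<close>.\<close>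
    moreover have "eventually (\<lambda>z. h z / (1 - cnj p * z) = (m z - m p) / (z - p)) (at p)"
    proof -
      have "eventually (\<lambda>z. z \<in> ball p e) (at p)" using e by (intro eventually_at_in_open') auto
      moreover have "eventually (\<lambda>z. z \<noteq> p) (at p)" by (simp add: eventually_at_filter)
      ultimately show ?thesis
      proof eventually_elim
        case (elim z)
        then have "z \<in> ball 0 \<rho>" using e by blast
        then have "1 - cnj p * z \<noteq> 0" using p1 \<rho> by (intro one_minus_cnj_mult_nonzero) auto
        then show ?case using elim by (simp add: h_def m_def[of p])
      qed
    qed
    ultimately have "((\<lambda>z. (m z - m p) / (z - p)) \<longlongrightarrow> l / (1 - cnj p * p)) (at p)"
      by (rule Lim_transform_eventually)
    then have "(m has_field_derivative (l / (1 - cnj p * p))) (at p)" by (simp add: has_field_derivative_iff)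
    then have md: "m field_differentiable at p" by (auto simp: field_differentiable_def)
    \<comment> \<open>The inverse Moebius map recovers \<open>g\<close> from \<open>m\<close>; its
      denominator is 1 at \<open>p\<close>.\<close>
    have "(\<lambda>z. (m z + g p) / (1 + cnj (g p) * m z)) field_differentiable at p"
      by (intro derivative_intros md) (simp add: m_def)
    then obtain D where "((\<lambda>z. (m z + g p) / (1 + cnj (g p) * m z)) has_field_derivative D) (at p)"
      by (auto simp: field_differentiable_def)
    moreover have "(m z + g p) / (1 + cnj (g p) * m z) = g z" if z: "z \<in> G" for z
    proof -
      have d: "1 - cnj (g p) * g z \<noteq> 0" "1 - cnj (g p) * g p \<noteq> 0"
        by (rule one_minus_cnj_mult_nonzero; use gp g1[OF z] in auto)+
      have "m z + g p = g z * (1 - cnj (g p) * g p) / (1 - cnj (g p) * g z)"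
        unfolding m_def using d by (simp add: divide_simps) (simp add: algebra_simps)
      moreover have "1 + cnj (g p) * m z = (1 - cnj (g p) * g p) / (1 - cnj (g p) * g z)"
        unfolding m_def using d by (simp add: divide_simps) (simp add: algebra_simps)
      ultimately show ?thesis using d by simp
    qed
    ultimately have "(g has_field_derivative D) (at p)"
      using has_field_derivative_transform_within_open[OF _ G(1) p] by blast
    then show ?thesis by (auto simp: field_differentiable_def)
  qed
qed

lemma pick_two_points_continuous:
  assumes G: "open G" "G \<subseteq> ball 0 1" and psd: "\<And>x y. {x,y} \<subseteq> G \<Longrightarrow> psd_on (pick_kernel g) {x,y}"
  shows "continuous_on G g"
proof -
  have "isCont g p" if p: "p \<in> G" for p
  proof -
    have p1: "cmod p < 1" using p G by auto
    obtain \<rho> where \<rho>: "cmod p < \<rho>" "\<rho> < 1" using dense[OF p1] by blast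
    have \<rho>0: "0 \<le> \<rho>" using \<rho>(1) norm_ge_zero[of p] by linarith
    have ev: "eventually (\<lambda>z. z \<in> G \<inter> ball 0 \<rho>) (at p)" using G p \<rho> by (intro eventually_at_in_open') auto
    have "((\<lambda>z. g z - g p) \<longlongrightarrow> 0) (at p)"
    proof (rule Lim_null_comparison)
      show "eventually (\<lambda>z. cmod (g z - g p) \<le> cmod (z - p) / (1 - \<rho>^2)) (at p)"
        using ev by eventually_elim (rule psd_on_pick_lipschitz[OF psd], use p \<rho> in auto)
      have "((\<lambda>z. cmod (z - p) / (1 - \<rho>^2)) \<longlongrightarrow> cmod (p - p) / (1 - \<rho>^2)) (at p)"
        using \<rho> \<rho>0 by (intro tendsto_intros) (auto simp: power2_eq_1_iff)
      then show "((\<lambda>z. cmod (z - p) / (1 - \<rho>^2)) \<longlongrightarrow> 0) (at p)" by simp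
    qed
    then show ?thesis unfolding isCont_def using LIM_zero_iff by blast
  qed
  then show ?thesis using continuous_at_imp_continuous_on by blast
qed

section \<open>Holomorphic functions off exceptional sets without limit points in the disk\<close>

lemma open_disk_minus_sparse:
  assumes "\<And>z. z \<in> ball 0 1 \<Longrightarrow> \<not> z islimpt N"
  shows "open (ball (0::complex) 1 - N)"
proof (rule openI)
  fix x assume x: "x \<in> ball (0::complex) 1 - N"
  then obtain e where e: "e > 0" "\<forall>y\<in>N. y \<noteq> x \<longrightarrow> \<not> dist y x < e"
    using assms[of x] unfolding islimpt_approachable by blast
  obtain e' where e': "e' > 0" "ball x e' \<subseteq> ball 0 1" using x openE[OF open_ball] by blast
  have "ball x (min e e') \<subseteq> ball 0 1 - N"
    using e e' x by (auto simp: dist_commute subset_iff)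
  then show "\<exists>T>0. ball x T \<subseteq> ball 0 1 - N" using e(1) e'(1) by (intro exI[of _ "min e e'"]) simp
qed

lemma punctured_ball_avoiding_sparse:
  assumes N: "\<not> z islimpt N" and z: "z \<in> ball (0::complex) 1"
  obtains e where "e > 0" "ball z e \<subseteq> ball 0 1" "ball z e - {z} \<subseteq> ball 0 1 - N"
proof -
  obtain e where e: "e > 0" "\<forall>y\<in>N. y \<noteq> z \<longrightarrow> \<not> dist y z < e"
    using N unfolding islimpt_approachable by blast
  obtain e' where e': "e' > 0" "ball z e' \<subseteq> ball 0 1" using z openE[OF open_ball] by blast
  show ?thesis
    by (rule that[of "min e e'"]) (use e e' in \<open>auto simp: dist_commute subset_iff\<close>)
qed

text \<open>Every point of \<open>N\<close> in the disk is isolated, so Riemann's theorem applies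
  there, and the bound 1 survives in the limit.\<close>

lemma bounded_holomorphic_extends_to_disk:
  assumes N: "\<And>z. z \<in> ball 0 1 \<Longrightarrow> \<not> z islimpt N"
    and g: "g holomorphic_on ball 0 1 - N" and b: "\<And>z. z \<in> ball 0 1 - N \<Longrightarrow> cmod (g z) \<le> 1"
  obtains G where "G holomorphic_on ball 0 1" "\<And>z. z \<in> ball 0 1 - N \<Longrightarrow> G z = g z"
    "\<And>z. z \<in> ball 0 1 \<Longrightarrow> cmod (G z) \<le> 1"
proof -
  note op = open_disk_minus_sparse[OF N]
  have an: "g analytic_on ball 0 1 - N" using g op by (simp add: analytic_on_open)
  have "remove_sings g analytic_on {z} \<and> cmod (remove_sings g z) \<le> 1" if z: "z \<in> ball 0 1" for z
  proof -
    obtain e where e: "e > 0" "ball z e \<subseteq> ball 0 1" "ball z e - {z} \<subseteq> ball 0 1 - N"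
      using punctured_ball_avoiding_sparse[OF N[OF z] z] .
    have hol: "g holomorphic_on ball z e - {z}" using g e(3) by (rule holomorphic_on_subset)
    have iso: "isolated_singularity_at g z"
      unfolding isolated_singularity_at_def using e(1) hol by (intro exI[of _ e]) (simp add: analytic_on_open open_Diff)
    have ev: "eventually (\<lambda>w. w \<in> ball z e - {z}) (at z)" using e(1) by (intro eventually_at_in_open) auto
    have bd: "eventually (\<lambda>w. cmod (g w) \<le> 1) (at z)"
      using ev by eventually_elim (use b e(3) in auto)
    then obtain h where h: "h holomorphic_on ball z e" "\<forall>w\<in>ball z e - {z}. h w = g w"
      using holomorphic_on_extend_bounded[OF hol] e(1) by auto
    have "(h \<longlongrightarrow> h z) (at z)"
      using holomorphic_on_imp_continuous_on[OF h(1)] e(1) by (simp add: continuous_on_eq_continuous_at isCont_def)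
    then have lim: "(g \<longlongrightarrow> h z) (at z)"
      by (rule Lim_transform_eventually) (use ev h(2) in \<open>auto elim: eventually_mono\<close>)
    have "cmod (h z) \<le> 1" by (rule tendsto_upperbound[OF tendsto_norm[OF lim] bd]) simp
    moreover have "remove_sings g z = h z" using lim by (rule remove_sings_eqI)
    ultimately show ?thesis using remove_sings_analytic_at[OF iso lim] by simp
  qed note R = this
  show ?thesis
  proof (rule that[of "remove_sings g"])
    have "remove_sings g analytic_on ball 0 1" using R analytic_on_analytic_at by blast
    then show "remove_sings g holomorphic_on ball 0 1" by (rule analytic_imp_holomorphic)
    show "remove_sings g z = g z" if "z \<in> ball 0 1 - N" for z
      using an that analytic_on_analytic_at by (intro remove_sings_at_analytic) blast
  qed (use R in blast)
qed

lemma psd_on_pick_kernel_sparse: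
  assumes N: "\<And>z. z \<in> ball 0 1 \<Longrightarrow> \<not> z islimpt N"
    and g: "g holomorphic_on ball 0 1 - N" and b: "\<And>z. z \<in> ball 0 1 - N \<Longrightarrow> cmod (g z) \<le> 1"
    and A: "finite A" "A \<subseteq> ball 0 1 - N"
  shows "psd_on (pick_kernel g) A"
proof -
  obtain G where G: "G holomorphic_on ball 0 1" "\<And>z. z \<in> ball 0 1 - N \<Longrightarrow> G z = g z"
    "\<And>z. z \<in> ball 0 1 \<Longrightarrow> cmod (G z) \<le> 1"
    using bounded_holomorphic_extends_to_disk[OF N g b] by blast
  have "psd_on (pick_kernel G) A" using psd_on_pick_kernel_schur[OF A(1) _ G(1,3)] A(2) by blast
  moreover have "herm_form (pick_kernel G) A c c = herm_form (pick_kernel g) A c c" for c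
    unfolding herm_form_def pick_kernel_def using G(2) A(2) by (intro sum.cong refl) (auto simp: subset_iff)
  ultimately show ?thesis by (simp add: psd_on_def)
qed

section \<open>The Schur complement of a Pick kernel\<close>

text \<open>\<open>(1 - z * cnj w) * K z w\<close> has rank two, built from the pair
  \<open>(1, f)\<close>, and Schur complements preserve this displacement structure. The new pair
  subtracts from \<open>(1, f z)\<close> the combination of the pairs \<open>(1, f y)\<close> with
  coefficients \<open>(1 - z) * r z y / (1 - y)\<close>; the quotient
  \<open>(1 - z) / (1 - y)\<close> expresses the normalisation at 1.\<close>

lemma schur_complement_pick_kernel:
  fixes f :: "complex \<Rightarrow> complex" and r :: "complex \<Rightarrow> complex \<Rightarrow> complex"
  defines "a \<equiv> \<lambda>z B. 1 - (1 - z) * (\<Sum>y\<in>B. r z y * (1 / (1 - y)))"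
    and "b \<equiv> \<lambda>z B. f z - (1 - z) * (\<Sum>y\<in>B. r z y * (1 / (1 - y)) * f y)"
  assumes B: "B \<subseteq> ball 0 1" and z: "z \<in> ball 0 1" and w: "w \<in> ball 0 1"
    and rz: "\<And>x. x \<in> B \<Longrightarrow> (\<Sum>y\<in>B. r z y * pick_kernel f y x) = pick_kernel f z x"
    and rw: "\<And>x. x \<in> B \<Longrightarrow> (\<Sum>y\<in>B. r w y * pick_kernel f y x) = pick_kernel f w x"
  shows "schur_complement (pick_kernel f) B r z w * (1 - z * cnj w) = a z B * cnj (a w B) - b z B * cnj (b w B)"
proof -
  let ?K = "pick_kernel f"
  define t where "t y = 1 / (1 - y)" for y :: complex
  have t: "(1 - y) * t y = 1" if "y \<in> B" for y
    using that B by (auto simp: t_def)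
  have ct: "(1 - cnj y) * cnj (t y) = 1" if "y \<in> B" for y
    using arg_cong[OF t[OF that], of cnj] by simp
  have K: "?K x y * (1 - x * cnj y) = 1 - f x * cnj (f y)" if "x \<in> ball 0 1" "y \<in> ball 0 1" for x y
    using one_minus_mult_cnj_nonzero[of x y] that by (simp add: pick_kernel_def)
  have Kcnj: "cnj (?K x y) = ?K y x" for x y by (simp add: pick_kernel_def mult.commute)
  \<comment> \<open>On \<open>B\<close> one has
    \<open>t y * (1 - y * cnj w) = cnj w + (1 - cnj w) * t y\<close>. This reduces the linear and
    the quadratic terms of \<open>a a* - b b*\<close> to these three sums, in \<open>E1\<close>,
    \<open>E2\<close> and \<open>E3\<close>; \<open>S\<close> is the term that
    \<open>schur_complement\<close> subtracts.\<close>
  define S where "S = (\<Sum>y\<in>B. r z y * ?K y w)"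
  define U where "U = (\<Sum>y\<in>B. r z y * t y * ?K y w)"
  define V where "V = (\<Sum>y\<in>B. cnj (r w y * t y) * ?K z y)"
  have R1: "(\<Sum>y'\<in>B. cnj (r w y') * ?K y y') = ?K y w" if "y \<in> B" for y
    using arg_cong[OF rw[OF that], of cnj] by (simp add: Kcnj)
  have S2: "(\<Sum>y\<in>B. cnj (r w y) * ?K z y) = S"
  proof -
    have "(\<Sum>y\<in>B. cnj (r w y) * ?K z y) = (\<Sum>y\<in>B. \<Sum>x\<in>B. cnj (r w y) * (r z x * ?K x y))"
      by (intro sum.cong refl) (simp add: rz[symmetric] sum_distrib_left)
    also have "\<dots> = (\<Sum>x\<in>B. r z x * (\<Sum>y\<in>B. cnj (r w y) * ?K x y))"
      by (subst sum.swap) (simp add: sum_distrib_left mult_ac)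
    also have "\<dots> = S" unfolding S_def by (intro sum.cong refl) (simp add: R1)
    finally show ?thesis .
  qed
  define A1 where "A1 = (\<Sum>y\<in>B. r z y * t y)"
  define C1 where "C1 = (\<Sum>y\<in>B. r z y * t y * f y)"
  define A2 where "A2 = (\<Sum>y\<in>B. cnj (r w y * t y))"
  define C2 where "C2 = (\<Sum>y\<in>B. cnj (r w y * t y * f y))"
  have E1: "A1 - C1 * cnj (f w) = cnj w * S + (1 - cnj w) * U"
  proof -
    have "A1 - C1 * cnj (f w) = (\<Sum>y\<in>B. r z y * (t y * (1 - f y * cnj (f w))))"
      unfolding A1_def C1_def sum_distrib_right sum_subtractf[symmetric]
      by (intro sum.cong refl) (simp add: algebra_simps)
    also have "\<dots> = (\<Sum>y\<in>B. cnj w * (r z y * ?K y w) + (1 - cnj w) * (r z y * t y * ?K y w))"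
    proof (intro sum.cong refl)
      fix y assume y: "y \<in> B"
      have "t y * (1 - f y * cnj (f w)) = ?K y w * (t y * (1 - y * cnj w))"
        using K[of y w] y B w by (simp add: mult_ac subset_iff)
      also have "t y * (1 - y * cnj w) = cnj w * ((1 - y) * t y) + (1 - cnj w) * t y" by (simp add: algebra_simps)
      finally have X: "t y * (1 - f y * cnj (f w)) = ?K y w * (cnj w * ((1 - y) * t y) + (1 - cnj w) * t y)" .
      show "r z y * (t y * (1 - f y * cnj (f w))) = cnj w * (r z y * ?K y w) + (1 - cnj w) * (r z y * t y * ?K y w)"
        unfolding X t[OF y] by (simp add: algebra_simps)
    qed
    finally show ?thesis unfolding S_def U_def by (simp add: sum.distrib sum_distrib_left)
  qed
  have E2: "A2 - f z * C2 = z * S + (1 - z) * V"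
  proof -
    have "A2 - f z * C2 = (\<Sum>y\<in>B. cnj (r w y) * (cnj (t y) * (1 - f z * cnj (f y))))"
      unfolding A2_def C2_def sum_distrib_left sum_subtractf[symmetric]
      by (intro sum.cong refl) (simp add: algebra_simps)
    also have "\<dots> = (\<Sum>y\<in>B. z * (cnj (r w y) * ?K z y) + (1 - z) * (cnj (r w y * t y) * ?K z y))"
    proof (intro sum.cong refl)
      fix y assume y: "y \<in> B"
      have "cnj (t y) * (1 - f z * cnj (f y)) = ?K z y * (cnj (t y) * (1 - z * cnj y))"
        using K[of z y] y B z by (simp add: mult_ac subset_iff)
      also have "cnj (t y) * (1 - z * cnj y) = z * ((1 - cnj y) * cnj (t y)) + (1 - z) * cnj (t y)" by (simp add: algebra_simps)
      finally have X: "cnj (t y) * (1 - f z * cnj (f y)) = ?K z y * (z * ((1 - cnj y) * cnj (t y)) + (1 - z) * cnj (t y))" .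
      show "cnj (r w y) * (cnj (t y) * (1 - f z * cnj (f y))) = z * (cnj (r w y) * ?K z y) + (1 - z) * (cnj (r w y * t y) * ?K z y)"
        unfolding X ct[OF y] by (simp add: algebra_simps)
    qed
    also have "\<dots> = z * (\<Sum>y\<in>B. cnj (r w y) * ?K z y) + (1 - z) * V"
      unfolding V_def by (simp only: sum.distrib sum_distrib_left)
    finally show ?thesis unfolding S2 .
  qed
  have E3: "A1 * A2 - C1 * C2 = U + V - S"
  proof -
    have "A1 * A2 - C1 * C2 = (\<Sum>y\<in>B. \<Sum>x\<in>B. r z y * cnj (r w x) * (t y * cnj (t x) * (1 - f y * cnj (f x))))"
      unfolding A1_def A2_def C1_def C2_def sum_product sum_subtractf[symmetric]
      by (intro sum.cong refl) (simp add: algebra_simps)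
    also have "\<dots> = (\<Sum>y\<in>B. \<Sum>x\<in>B. r z y * t y * (cnj (r w x) * ?K y x) + cnj (r w x * t x) * (r z y * ?K y x)
        - r z y * (cnj (r w x) * ?K y x))"
    proof (intro sum.cong refl)
      fix y x assume y: "y \<in> B" and x: "x \<in> B"
      have "t y * cnj (t x) * (1 - f y * cnj (f x)) = ?K y x * (t y * cnj (t x) * (1 - y * cnj x))"
        using K[of y x] y x B by (simp add: mult_ac subset_iff)
      also have "t y * cnj (t x) * (1 - y * cnj x) =
          t y * ((1 - cnj x) * cnj (t x)) + cnj (t x) * ((1 - y) * t y) - ((1 - y) * t y) * ((1 - cnj x) * cnj (t x))"
        by (simp add: algebra_simps)
      finally have X: "t y * cnj (t x) * (1 - f y * cnj (f x)) = ?K y x *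
          (t y * ((1 - cnj x) * cnj (t x)) + cnj (t x) * ((1 - y) * t y) - ((1 - y) * t y) * ((1 - cnj x) * cnj (t x)))" .
      show "r z y * cnj (r w x) * (t y * cnj (t x) * (1 - f y * cnj (f x))) =
          r z y * t y * (cnj (r w x) * ?K y x) + cnj (r w x * t x) * (r z y * ?K y x) - r z y * (cnj (r w x) * ?K y x)"
        unfolding X t[OF y] ct[OF x] by (simp add: algebra_simps)
    qed
    also have "\<dots> = (\<Sum>y\<in>B. r z y * t y * (\<Sum>x\<in>B. cnj (r w x) * ?K y x))
        + (\<Sum>y\<in>B. \<Sum>x\<in>B. cnj (r w x * t x) * (r z y * ?K y x)) - (\<Sum>y\<in>B. r z y * (\<Sum>x\<in>B. cnj (r w x) * ?K y x))"
      by (simp only: sum.distrib sum_subtractf sum_distrib_left)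
    also have "(\<Sum>y\<in>B. \<Sum>x\<in>B. cnj (r w x * t x) * (r z y * ?K y x)) = (\<Sum>x\<in>B. cnj (r w x * t x) * (\<Sum>y\<in>B. r z y * ?K y x))"
      by (subst sum.swap) (simp only: sum_distrib_left)
    also have "\<dots> = V" unfolding V_def by (intro sum.cong refl) (simp add: rz)
    also have "(\<Sum>y\<in>B. r z y * t y * (\<Sum>x\<in>B. cnj (r w x) * ?K y x)) = U"
      unfolding U_def by (intro sum.cong refl) (simp add: R1)
    also have "(\<Sum>y\<in>B. r z y * (\<Sum>x\<in>B. cnj (r w x) * ?K y x)) = S"
      unfolding S_def by (intro sum.cong refl) (simp add: R1)
    finally show ?thesis .
  qed
  have az: "a z B = 1 - (1 - z) * A1" and bz: "b z B = f z - (1 - z) * C1"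
    by (simp_all add: a_def b_def A1_def C1_def t_def)
  have aw: "cnj (a w B) = 1 - (1 - cnj w) * A2" and bw: "cnj (b w B) = cnj (f w) - (1 - cnj w) * C2"
    by (simp_all add: a_def b_def A2_def C2_def t_def)
  have "a z B * cnj (a w B) - b z B * cnj (b w B) = (1 - f z * cnj (f w)) - (1 - z) * (A1 - C1 * cnj (f w))
      - (1 - cnj w) * (A2 - f z * C2) + (1 - z) * (1 - cnj w) * (A1 * A2 - C1 * C2)"
    unfolding az bz aw bw by (simp add: algebra_simps)
  \<comment> \<open>\<open>U\<close> and \<open>V\<close> cancel, and the coefficients of
    \<open>S\<close> add up to \<open>- (1 - z * cnj w)\<close>.\<close>
  also have "\<dots> = (1 - f z * cnj (f w)) - S * (1 - z * cnj w)"
    unfolding E1 E2 E3 by (simp add: algebra_simps)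
  also have "\<dots> = schur_complement ?K B r z w * (1 - z * cnj w)"
    unfolding schur_complement_def S_def[symmetric] K[OF z w, symmetric] by (simp add: algebra_simps)
  finally show ?thesis by simp
qed

lemma herm_form_weighted:
  assumes "\<And>z w. z \<in> A \<Longrightarrow> w \<in> A \<Longrightarrow> K z w = a z * cnj (a w) * H z w"
  shows "herm_form K A c c = herm_form H A (\<lambda>z. c z * a z) (\<lambda>z. c z * a z)"
  unfolding herm_form_def by (intro sum.cong refl) (simp add: assms mult_ac)

text \<open>Only the accumulation condition of \<open>discrete_in_disk\<close>, so that subsets,
  finite unions and zero sets inherit it directly.\<close>

definition sparse_in_disk :: "complex set \<Rightarrow> bool" where
  "sparse_in_disk N \<longleftrightarrow> (\<forall>z\<in>ball 0 1. \<not> z islimpt N)"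

lemma sparse_in_disk_Un: "sparse_in_disk M \<Longrightarrow> sparse_in_disk N \<Longrightarrow> sparse_in_disk (M \<union> N)"
  by (auto simp: sparse_in_disk_def islimpt_Un)

lemma sparse_in_disk_subset: "sparse_in_disk N \<Longrightarrow> M \<subseteq> N \<Longrightarrow> sparse_in_disk M"
  unfolding sparse_in_disk_def using islimpt_subset by blast

lemma sparse_in_disk_finite: "finite N \<Longrightarrow> sparse_in_disk N"
  by (simp add: sparse_in_disk_def islimpt_finite)

text \<open>\<open>K z x\<close> is affine in \<open>f z\<close> with coefficients rational in
  \<open>z\<close>, hence so are \<open>r z y\<close>, \<open>a\<close> and \<open>b\<close>;
  collecting terms gives the matrix of the \<open>q\<close>'s. Its possible poles
  \<open>1 / cnj x\<close> lie outside the closed disk. The factor \<open>1 - z\<close> makes it the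
  identity matrix at 1, and the identity theorem then makes the zeros of the determinant
  sparse.\<close>

lemma pick_kernel_linear_fractional:
  assumes B: "finite B" "B \<subseteq> ball 0 1" and M: "\<And>x y. x \<in> B \<Longrightarrow> y \<in> B \<Longrightarrow> (\<Sum>t\<in>B. M x t * pick_kernel f t y) = (if x = y then 1 else 0)"
  obtains r q1 q2 q3 q4 where
    "\<And>z x. x \<in> B \<Longrightarrow> (\<Sum>y\<in>B. r z y * pick_kernel f y x) = pick_kernel f z x"
    "\<And>z w. z \<in> ball 0 1 \<Longrightarrow> w \<in> ball 0 1 \<Longrightarrow> schur_complement (pick_kernel f) B r z w * (1 - z * cnj w) =
       (q1 z + f z * q2 z) * cnj (q1 w + f w * q2 w) - (q3 z + f z * q4 z) * cnj (q3 w + f w * q4 w)"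
    "q1 holomorphic_on ball 0 1" "q2 holomorphic_on ball 0 1" "q3 holomorphic_on ball 0 1" "q4 holomorphic_on ball 0 1"
    "sparse_in_disk {z \<in> ball 0 1. q1 z * q4 z - q2 z * q3 z = 0}"
proof -
  let ?K = "pick_kernel f"
  \<comment> \<open>The row \<open>K(z,B)\<close> times the inverse matrix \<open>M\<close>.\<close>
  define r where "r z y = (\<Sum>x\<in>B. ?K z x * M x y)" for z y
  have r: "(\<Sum>y\<in>B. r z y * ?K y x) = ?K z x" if x: "x \<in> B" for z x
  proof -
    have "(\<Sum>y\<in>B. r z y * ?K y x) = (\<Sum>y\<in>B. \<Sum>u\<in>B. ?K z u * (M u y * ?K y x))"
      by (simp add: r_def sum_distrib_right mult.assoc)
    also have "\<dots> = (\<Sum>u\<in>B. ?K z u * (\<Sum>y\<in>B. M u y * ?K y x))"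
      by (subst sum.swap) (simp only: sum_distrib_left)
    also have "\<dots> = (\<Sum>u\<in>B. ?K z u * (if u = x then 1 else 0))"
      using M x by (intro sum.cong refl) simp
    also have "\<dots> = (\<Sum>u\<in>B. if u = x then ?K z x else 0)" by (intro sum.cong refl) simp
    also have "\<dots> = ?K z x" using B x by simp
    finally show ?thesis .
  qed
  define m where "m x = (\<Sum>y\<in>B. M x y * (1 / (1 - y)))" for x
  define n where "n x = (\<Sum>y\<in>B. M x y * (1 / (1 - y)) * f y)" for x
  define q1 where "q1 z = 1 - (1 - z) * (\<Sum>x\<in>B. 1 / (1 - z * cnj x) * m x)" for z
  define q2 where "q2 z = (1 - z) * (\<Sum>x\<in>B. cnj (f x) / (1 - z * cnj x) * m x)" for z
  define q3 where "q3 z = - (1 - z) * (\<Sum>x\<in>B. 1 / (1 - z * cnj x) * n x)" for z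
  define q4 where "q4 z = 1 + (1 - z) * (\<Sum>x\<in>B. cnj (f x) / (1 - z * cnj x) * n x)" for z
  have split: "(\<Sum>x\<in>B. ?K z x * e x) = (\<Sum>x\<in>B. 1 / (1 - z * cnj x) * e x) - f z * (\<Sum>x\<in>B. cnj (f x) / (1 - z * cnj x) * e x)" for z e
    unfolding sum_distrib_left sum_subtractf[symmetric]
    by (intro sum.cong refl) (simp add: pick_kernel_def diff_divide_distrib algebra_simps)
  have a: "1 - (1 - z) * (\<Sum>y\<in>B. r z y * (1 / (1 - y))) = q1 z + f z * q2 z" for z
  proof -
    have X: "(\<Sum>y\<in>B. r z y * (1 / (1 - y))) = (\<Sum>x\<in>B. ?K z x * m x)"
      unfolding r_def m_def sum_distrib_right sum_distrib_left by (subst sum.swap) (simp only: mult.assoc)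
    show ?thesis unfolding X split q1_def q2_def by (simp add: algebra_simps)
  qed
  have b: "f z - (1 - z) * (\<Sum>y\<in>B. r z y * (1 / (1 - y)) * f y) = q3 z + f z * q4 z" for z
  proof -
    have X: "(\<Sum>y\<in>B. r z y * (1 / (1 - y)) * f y) = (\<Sum>x\<in>B. ?K z x * n x)"
      unfolding r_def n_def sum_distrib_right sum_distrib_left by (subst sum.swap) (simp only: mult.assoc)
    show ?thesis unfolding X split q3_def q4_def by (simp add: algebra_simps)
  qed
  text \<open>An open convex set that contains the disk and the point \<open>1\<close>, where the determinant equals \<open>1\<close>.\<close>
  define T where "T = (\<Inter>x\<in>B. {z. Re (z * cnj x) < 1})"
  have T: "open T" unfolding T_def using B(1)
    by (intro open_INT ballI open_Collect_less continuous_intros)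
  have "convex {z. Re (z * cnj x) < 1}" for x
    using convex_halfspace_lt[of x 1] by (simp add: inner_complex_def algebra_simps)
  then have Tc: "connected T" unfolding T_def by (intro convex_connected convex_INT)
  have Tball: "ball 0 1 \<subseteq> T"
  proof
    fix z :: complex assume z: "z \<in> ball 0 1"
    have "Re (z * cnj x) < 1" if "x \<in> B" for x
    proof -
      have "Re (z * cnj x) \<le> cmod z * cmod x" using complex_Re_le_cmod[of "z * cnj x"] by (simp add: norm_mult)
      also have "\<dots> < 1 * 1" using z that B(2) by (intro mult_strict_mono') (auto simp: subset_iff)
      finally show ?thesis by simp
    qed
    then show "z \<in> T" by (simp add: T_def)
  qed
  have T1: "1 \<in> T"
    unfolding T_def using B(2) complex_Re_le_cmod by (force simp: subset_iff intro: le_less_trans)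
  have nz: "1 - z * cnj x \<noteq> 0" if "z \<in> T" "x \<in> B" for z x
  proof
    assume "1 - z * cnj x = 0"
    then have "z * cnj x = 1" by simp
    then have "Re (z * cnj x) = 1" by (simp only: one_complex.sel)
    moreover have "Re (z * cnj x) < 1" using that unfolding T_def by blast
    ultimately show False by linarith
  qed
  have hol: "q1 holomorphic_on T" "q2 holomorphic_on T" "q3 holomorphic_on T" "q4 holomorphic_on T"
    unfolding q1_def q2_def q3_def q4_def by (intro holomorphic_intros; use nz in blast)+
  let ?d = "\<lambda>z. q1 z * q4 z - q2 z * q3 z"
  have "sparse_in_disk {z \<in> ball 0 1. ?d z = 0}"
    unfolding sparse_in_disk_def
  proof
    fix p :: complex assume p: "p \<in> ball 0 1"
    show "\<not> p islimpt {z \<in> ball 0 1. ?d z = 0}"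
    proof
      assume lim: "p islimpt {z \<in> ball 0 1. ?d z = 0}"
      have "?d 1 = 0"
        by (rule analytic_continuation[where f = ?d and S = T and U = "{z \<in> ball 0 1. ?d z = 0}" and \<xi> = p])
          (use T Tc Tball p lim T1 hol in \<open>auto intro!: holomorphic_intros\<close>)
      then show False by (simp add: q1_def q2_def q3_def q4_def)
    qed
  qed
  moreover have "schur_complement ?K B r z w * (1 - z * cnj w) =
       (q1 z + f z * q2 z) * cnj (q1 w + f w * q2 w) - (q3 z + f z * q4 z) * cnj (q3 w + f w * q4 w)"
    if "z \<in> ball 0 1" "w \<in> ball 0 1" for z w
    unfolding a[symmetric] b[symmetric]
    by (rule schur_complement_pick_kernel[OF B(2) that r r])
  ultimately show ?thesis
    using that[of r q1 q2 q3 q4] r hol Tball holomorphic_on_subset by blast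
qed

section \<open>Propagation of the number of negative squares\<close>

text \<open>Removes the bound on the number of added points. The second conclusion matters as well:
  in part (2) it is obtained once and then fed back as the second alternative of
  \<open>three\<close>, which leaves only two points to check.\<close>

lemma pick_negative_squares_propagate:
  assumes L: "sparse_in_disk \<Lambda>" and B: "finite B" "B \<subseteq> ball 0 1 - \<Lambda>" "nondegenerate_on (pick_kernel f) B"
    and neg: "has_negative_squares (pick_kernel f) B k"
    and two: "\<And>A. finite A \<Longrightarrow> A \<subseteq> ball 0 1 - \<Lambda> \<Longrightarrow> card A \<le> 2 \<Longrightarrow> \<not> has_negative_squares (pick_kernel f) (B \<union> A) (Suc k)"
    and three: "(\<forall>A. finite A \<longrightarrow> A \<subseteq> ball 0 1 - \<Lambda> \<longrightarrow> card A \<le> 3 \<longrightarrow> \<not> has_negative_squares (pick_kernel f) (B \<union> A) (Suc k))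
      \<or> (\<exists>N. sparse_in_disk N \<and> f holomorphic_on ball 0 1 - N)"
  shows "(\<forall>A. finite A \<longrightarrow> A \<subseteq> ball 0 1 - \<Lambda> \<longrightarrow> \<not> has_negative_squares (pick_kernel f) A (Suc k))
    \<and> (\<exists>N. sparse_in_disk N \<and> f holomorphic_on ball 0 1 - N)"
proof -
  let ?K = "pick_kernel f"
  define D where "D = ball (0::complex) 1 - \<Lambda>"
  have Bb: "B \<subseteq> ball 0 1" using B by blast
  obtain M where M: "\<And>x y. x \<in> B \<Longrightarrow> y \<in> B \<Longrightarrow> (\<Sum>t\<in>B. M x t * ?K t y) = (if x = y then 1 else 0)"
    using nondegenerate_on_left_inverse[OF B(1,3)] by blast
  obtain r q1 q2 q3 q4 where r: "\<And>z x. x \<in> B \<Longrightarrow> (\<Sum>y\<in>B. r z y * ?K y x) = ?K z x"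
    and fac: "\<And>z w. z \<in> ball 0 1 \<Longrightarrow> w \<in> ball 0 1 \<Longrightarrow> schur_complement ?K B r z w * (1 - z * cnj w) =
       (q1 z + f z * q2 z) * cnj (q1 w + f w * q2 w) - (q3 z + f z * q4 z) * cnj (q3 w + f w * q4 w)"
    and hol: "q1 holomorphic_on ball 0 1" "q2 holomorphic_on ball 0 1" "q3 holomorphic_on ball 0 1" "q4 holomorphic_on ball 0 1"
    and sp: "sparse_in_disk {z \<in> ball 0 1. q1 z * q4 z - q2 z * q3 z = 0}"
    using pick_kernel_linear_fractional[OF B(1) Bb M] by blast
  let ?S = "schur_complement ?K B r"
  define Z where "Z = {z \<in> ball 0 1. q1 z * q4 z - q2 z * q3 z = 0}"
  define a where "a z = q1 z + f z * q2 z" for z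
  define b where "b z = q3 z + f z * q4 z" for z
  define g where "g z = b z / a z" for z
  \<comment> \<open>Cramer's rule: \<open>det\<close> shows that \<open>a\<close> and
    \<open>b\<close> can vanish together only at zeros of the determinant, and \<open>det'\<close>
    recovers \<open>f\<close> from them.\<close>
  have det: "a z * q4 z - b z * q2 z = q1 z * q4 z - q2 z * q3 z" for z
    by (simp add: a_def b_def algebra_simps)
  have det': "b z * q1 z - a z * q3 z = f z * (q1 z * q4 z - q2 z * q3 z)" for z
    by (simp add: a_def b_def algebra_simps)
  have fac': "?S z w = (a z * cnj (a w) - b z * cnj (b w)) / (1 - z * cnj w)" if "z \<in> ball 0 1" "w \<in> ball 0 1" for z w
    using fac[OF that] one_minus_mult_cnj_nonzero[of z w] that by (simp add: a_def b_def field_simps)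
  have psdS: "psd_on ?S A" if A: "finite A" "A \<subseteq> D - B" and n: "\<not> has_negative_squares ?K (B \<union> A) (Suc k)" for A
  proof -
    have "psd_on ?S ((B \<union> A) - B)"
      by (rule psd_on_schur_complement[OF _ _ r hermitian_pick_kernel neg n]) (use A B in auto)
    moreover have "(B \<union> A) - B = A" using A by auto
    ultimately show ?thesis by simp
  qed
  have psd2: "psd_on ?S {x,y}" if "{x,y} \<subseteq> D - B" for x y
    using that by (intro psdS two) (auto simp: D_def card_insert_if)
  \<comment> \<open>At a zero of \<open>a\<close> the diagonal entry is
    \<open>- |b|^2 / (1 - |z|^2)\<close>, so positivity at this one point forces \<open>b\<close> to
    vanish.\<close>
  have ab: "b z = 0" if z: "z \<in> D - B" and az: "a z = 0" for z
  proof -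
    have zb: "z \<in> ball 0 1" using z by (simp add: D_def)
    have "0 \<le> Re (?S z z)" using psd_on_diagonal psd2[of z z] z by simp
    also have "?S z z = - of_real ((cmod (b z))^2 / (1 - (cmod z)^2))"
      unfolding fac'[OF zb zb] az by (simp add: complex_norm_square del: of_real_power)
    finally have "(cmod (b z))^2 / (1 - (cmod z)^2) \<le> 0" by simp
    moreover have "1 - (cmod z)^2 > 0" using zb by (simp add: abs_square_less_1)
    ultimately have "(cmod (b z))^2 \<le> 0" by (simp add: divide_le_0_iff)
    then show ?thesis by simp
  qed
  define E where "E = {z \<in> D - B. a z = 0}"
  have EZ: "E \<subseteq> Z"
  proof
    fix z assume z: "z \<in> E"
    then have "a z = 0" "b z = 0" using ab by (auto simp: E_def)
    then show "z \<in> Z" using det[of z] z by (simp add: Z_def E_def D_def)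
  qed
  define N where "N = \<Lambda> \<union> B \<union> E"
  have N: "sparse_in_disk N"
    unfolding N_def using L B(1) sp EZ sparse_in_disk_subset unfolding Z_def
    by (intro sparse_in_disk_Un) (auto intro: sparse_in_disk_finite)
  define G where "G = ball 0 1 - N"
  have G: "G = {z \<in> D - B. a z \<noteq> 0}" by (auto simp: G_def N_def E_def D_def)
  have opG: "open G" unfolding G_def using N by (intro open_disk_minus_sparse) (auto simp: sparse_in_disk_def)
  \<comment> \<open>This holds at the zeros of \<open>a\<close> too: there \<open>b\<close> vanishes
    as well and both sides are 0.\<close>
  have SK: "?S z w = a z * cnj (a w) * pick_kernel g z w" if "z \<in> D - B" "w \<in> D - B" for z w
  proof -
    have ball: "z \<in> ball 0 1" "w \<in> ball 0 1" using that by (auto simp: D_def)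
    have "b z = a z * g z" "b w = a w * g w" using ab that by (auto simp: g_def)
    then show ?thesis unfolding fac'[OF ball] by (simp add: pick_kernel_def algebra_simps)
  qed
  have psdg: "psd_on (pick_kernel g) A" if A: "finite A" "A \<subseteq> G" and n: "\<not> has_negative_squares ?K (B \<union> A) (Suc k)" for A
    unfolding psd_on_def
  proof
    fix c :: "complex \<Rightarrow> complex"
    have AD: "A \<subseteq> D - B" using A G by auto
    have "herm_form ?S A (\<lambda>z. c z / a z) (\<lambda>z. c z / a z) =
        herm_form (pick_kernel g) A (\<lambda>z. c z / a z * a z) (\<lambda>z. c z / a z * a z)"
      by (rule herm_form_weighted) (use SK AD in blast)
    also have "\<dots> = herm_form (pick_kernel g) A c c"
      by (rule herm_form_cong) (use A G in auto)
    finally show "0 \<le> Re (herm_form (pick_kernel g) A c c)"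
      using psdS[OF A(1) AD n] unfolding psd_on_def by metis
  qed
  have GD: "G \<subseteq> ball 0 1 - \<Lambda>" by (auto simp: G_def N_def)
  have psdg2: "psd_on (pick_kernel g) {x,y}" if "{x,y} \<subseteq> G" for x y
    using that GD by (intro psdg two) (auto simp: card_insert_if)
  have g1: "cmod (g z) \<le> 1" if "z \<in> G" for z
    using psd_on_pick_norm_le_1[of g z] psdg2[of z z] that GD by auto
  have gd: "g field_differentiable at p" if p: "p \<in> G" for p
    using three
  proof
    assume 3: "\<forall>A. finite A \<longrightarrow> A \<subseteq> ball 0 1 - \<Lambda> \<longrightarrow> card A \<le> 3 \<longrightarrow> \<not> has_negative_squares ?K (B \<union> A) (Suc k)"
    show ?thesis
    proof (rule pick_three_points_differentiable[OF opG _ _ p])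
      fix x y z assume xyz: "{x,y,z} \<subseteq> G"
      have "card {x,y,z} \<le> 3" by (simp add: card_insert_if)
      then have n: "\<not> has_negative_squares ?K (B \<union> {x,y,z}) (Suc k)"
        using 3[rule_format, of "{x,y,z}"] xyz GD by blast
      show "psd_on (pick_kernel g) {x,y,z}" by (rule psdg[OF _ xyz n]) simp
    qed (use GD in auto)
  next
    assume "\<exists>N. sparse_in_disk N \<and> f holomorphic_on ball 0 1 - N"
    then obtain N0 where N0: "sparse_in_disk N0" "f holomorphic_on ball 0 1 - N0" by blast
    have "sparse_in_disk (N \<union> N0)" using N N0 by (intro sparse_in_disk_Un)
    \<comment> \<open>\<open>p\<close> itself may lie in \<open>N0\<close>, so holomorphy is known
      only on the punctured ball. Continuity from two-point positivity makes the singularity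
      removable with the right value at \<open>p\<close>.\<close>
    then obtain e where e: "e > 0" "ball p e \<subseteq> ball 0 1" "ball p e - {p} \<subseteq> ball 0 1 - (N \<union> N0)"
      using punctured_ball_avoiding_sparse[of p "N \<union> N0"] p GD unfolding sparse_in_disk_def by blast
    have cont: "continuous_on G g"
      by (rule pick_two_points_continuous[OF opG _ psdg2]) (use GD in auto)
    have eG: "ball p e \<subseteq> G" using e p by (auto simp: G_def)
    have sub: "ball p e - {p} \<subseteq> ball 0 1 - N0" "ball p e - {p} \<subseteq> ball 0 1" using e by auto
    have hp: "g holomorphic_on ball p e - {p}"
      unfolding g_def a_def b_def
      by (intro holomorphic_intros holomorphic_on_subset[OF N0(2) sub(1)] holomorphic_on_subset[OF hol(1) sub(2)]
         holomorphic_on_subset[OF hol(2) sub(2)] holomorphic_on_subset[OF hol(3) sub(2)] holomorphic_on_subset[OF hol(4) sub(2)])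
        (use eG G in \<open>auto simp: a_def\<close>)
    have "g holomorphic_on ball p e"
      by (rule no_isolated_singularity[OF continuous_on_subset[OF cont eG] hp open_ball]) simp
    then show ?thesis using e(1) holomorphic_on_imp_differentiable_at[of g "ball p e" p] by simp
  qed
  have gh: "g holomorphic_on ball 0 1 - N"
    using gd unfolding G_def[symmetric] holomorphic_on_def by (blast intro: field_differentiable_at_within)
  have psd_all: "psd_on (pick_kernel g) A" if "finite A" "A \<subseteq> G" for A
    by (rule psd_on_pick_kernel_sparse[OF _ gh]) (use that g1 N in \<open>auto simp: G_def sparse_in_disk_def\<close>)
  have "\<not> has_negative_squares ?K A (Suc k)" if A: "finite A" "A \<subseteq> ball 0 1 - \<Lambda>" for A
  proof -
    have psd: "psd_on ?S ((A \<union> B) - B)"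
      unfolding psd_on_def
    proof
      fix c :: "complex \<Rightarrow> complex"
      let ?A = "(A \<union> B) - B"
      let ?c = "\<lambda>z. c z * a z"
      have AD: "?A \<subseteq> D - B" using A by (auto simp: D_def)
      have "herm_form ?S ?A c c = herm_form (pick_kernel g) ?A ?c ?c"
        by (rule herm_form_weighted) (use SK AD in blast)
      \<comment> \<open>The weight \<open>a\<close> is 0 at the points of \<open>?A\<close> outside
        \<open>G\<close>, so only points where \<open>g\<close> is known to be holomorphic
        contribute.\<close>
      also have "\<dots> = herm_form (pick_kernel g) (?A \<inter> G) ?c ?c"
        by (rule herm_form_restrict) (use A B AD G in auto)
      finally show "0 \<le> Re (herm_form ?S ?A c c)"
        using psd_all[of "?A \<inter> G"] A B by (simp add: psd_on_def)
    qed
    have nB: "\<not> has_negative_squares ?K B (Suc k)" using two[of "{}"] by simp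
    have "\<not> has_negative_squares ?K (A \<union> B) (Suc k)"
      by (rule not_has_negative_squares_schur_complement[OF _ _ r hermitian_pick_kernel neg nB psd]) (use A B in auto)
    moreover have "finite (A \<union> B)" using A B by simp
    ultimately show ?thesis using has_negative_squares_mono[of ?K A "Suc k" "A \<union> B"] by blast
  qed
  moreover have "f holomorphic_on ball 0 1 - (N \<union> Z)"
  proof -
    have sub: "ball 0 1 - (N \<union> Z) \<subseteq> ball 0 1 - N" "ball 0 1 - (N \<union> Z) \<subseteq> ball (0::complex) 1" by auto
    \<comment> \<open>The linear fractional map is inverted: \<open>f\<close> is holomorphic
      wherever \<open>g\<close> is and the determinant does not vanish.\<close>
    have X: "q4 z - g z * q2 z \<noteq> 0 \<and> (g z * q1 z - q3 z) / (q4 z - g z * q2 z) = f z"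
      if z: "z \<in> ball 0 1 - (N \<union> Z)" for z
    proof -
      have az: "a z \<noteq> 0" using z G G_def by blast
      have dz: "q1 z * q4 z - q2 z * q3 z \<noteq> 0" using z by (auto simp: Z_def)
      have 1: "q4 z - g z * q2 z = (q1 z * q4 z - q2 z * q3 z) / a z"
        unfolding det[symmetric] g_def using az by (simp add: field_simps)
      have 2: "g z * q1 z - q3 z = f z * (q1 z * q4 z - q2 z * q3 z) / a z"
        unfolding det'[symmetric] g_def using az by (simp add: field_simps)
      show ?thesis unfolding 1 2 using az dz by simp
    qed
    have "(\<lambda>z. (g z * q1 z - q3 z) / (q4 z - g z * q2 z)) holomorphic_on ball 0 1 - (N \<union> Z)"
      by (intro holomorphic_intros holomorphic_on_subset[OF gh sub(1)] holomorphic_on_subset[OF hol(1) sub(2)]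
         holomorphic_on_subset[OF hol(2) sub(2)] holomorphic_on_subset[OF hol(3) sub(2)] holomorphic_on_subset[OF hol(4) sub(2)])
        (use X in blast)
    then show ?thesis by (rule holomorphic_transform) (use X in blast)
  qed
  moreover have "sparse_in_disk (N \<union> Z)" using N sp by (intro sparse_in_disk_Un) (simp_all add: Z_def)
  ultimately show ?thesis by blast
qed

section \<open>The maxima over tuples and the theorem\<close>

lemma sq_minus_le_dim:
  assumes "A \<in> carrier_mat n n"
  shows "sq_minus A \<le> n"
proof -
  have "sq_minus A \<le> size (proots (char_poly A))" unfolding sq_minus_def by (rule size_filter_mset_lesseq)
  also have "\<dots> \<le> degree (char_poly A)" by (rule size_proots_le)
  finally show ?thesis using degree_monic_char_poly[OF assms] by simp
qed

text \<open>\<open>k_num\<close> looks at tuples of length exactly \<open>n\<close>, so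
  \<open>A\<close> is padded with further points of the infinite set \<open>D\<close>; enlarging a
  set never loses negative squares.\<close>

lemma has_negative_squares_le_k_num:
  assumes D: "infinite D" and A: "finite A" "A \<subseteq> D" "card A \<le> n" "has_negative_squares (pick_kernel f) A j"
  shows "j \<le> k_num D f n"
proof -
  have "infinite (D - A)" using D A by simp
  then obtain C where C: "finite C" "card C = n - card A" "C \<subseteq> D - A"
    using infinite_arbitrarily_large by metis
  have "finite (A \<union> C)" using A C by simp
  then obtain zs where zs: "set zs = A \<union> C" "distinct zs" using finite_distinct_list by blast
  have "card (A \<union> C) = n" using A C by (subst card_Un_disjoint) auto
  then have len: "length zs = n" using zs distinct_card by metis
  have "has_negative_squares (pick_kernel f) (set zs) j"
    unfolding zs(1) using A C by (intro has_negative_squares_mono[OF A(4)]) auto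
  then have j: "j \<le> sq_minus (pick_matrix f zs)" using has_negative_squares_pick_iff[OF zs(2)] by blast
  have carrier: "pick_matrix f us \<in> carrier_mat (length us) (length us)" for us by (simp add: pick_matrix_def)
  show ?thesis
  proof (cases "n = 0")
    case True
    then show ?thesis using j sq_minus_le_dim[OF carrier[of zs]] len by simp
  next
    case False
    let ?V = "{sq_minus (pick_matrix f zs) | zs. length zs = n \<and> distinct zs \<and> set zs \<subseteq> D}"
    have "?V \<subseteq> {..n}" using sq_minus_le_dim[OF carrier] by auto
    then have "finite ?V" by (rule finite_subset) simp
    moreover have "sq_minus (pick_matrix f zs) \<in> ?V" using zs len A C by blast
    ultimately have "sq_minus (pick_matrix f zs) \<le> Max ?V" by (rule Max_ge)
    then show ?thesis using j False by (simp add: k_num_def)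
  qed
qed

lemma k_num_attained:
  assumes D: "infinite D"
  obtains zs where "length zs = n" "distinct zs" "set zs \<subseteq> D" "sq_minus (pick_matrix f zs) = k_num D f n"
proof -
  have carrier: "pick_matrix f us \<in> carrier_mat (length us) (length us)" for us by (simp add: pick_matrix_def)
  show ?thesis
  proof (cases "n = 0")
    case True
    then show ?thesis using that[of "[]"] sq_minus_le_dim[OF carrier[of "[]"]] by (simp add: k_num_def)
  next
    case False
    let ?V = "{sq_minus (pick_matrix f zs) | zs. length zs = n \<and> distinct zs \<and> set zs \<subseteq> D}"
    have "?V \<subseteq> {..n}" using sq_minus_le_dim[OF carrier] by auto
    then have fin: "finite ?V" by (rule finite_subset) simp
    obtain C where C: "finite C" "card C = n" "C \<subseteq> D" using infinite_arbitrarily_large[OF D] by blast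
    then obtain zs where "set zs = C" "distinct zs" using finite_distinct_list by blast
    then have "?V \<noteq> {}" using C distinct_card by fastforce
    then have "Max ?V \<in> ?V" using fin by (rule Max_in[rotated])
    then show ?thesis using that False by (auto simp: k_num_def)
  qed
qed

theorem theorem1p11:
  fixes \<Lambda> :: "complex set" and f :: "complex \<Rightarrow> complex" and \<kappa> :: nat
  assumes "discrete_in_disk \<Lambda>"
  shows "(k_num (unit_disk - \<Lambda>) f (2*\<kappa>) = \<kappa> \<and> k_num (unit_disk - \<Lambda>) f (2*\<kappa>+3) = \<kappa>
            \<longrightarrow> in_S \<kappa> (unit_disk - \<Lambda>) f) \<and>
         (in_S \<kappa> (unit_disk - \<Lambda>) f \<longrightarrow> k_num (unit_disk - \<Lambda>) f (2*\<kappa>) = \<kappa>)"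
proof -
  let ?K = "pick_kernel f"
  define D where "D = ball (0::complex) 1 - \<Lambda>"
  have D: "unit_disk - \<Lambda> = D" by (simp add: D_def unit_disk_eq_ball)
  have L: "sparse_in_disk \<Lambda>"
    using assms by (auto simp: discrete_in_disk_def sparse_in_disk_def unit_disk_eq_ball)
  have "uncountable D"
    unfolding D_def using assms by (intro uncountable_minus_countable uncountable_ball) (auto simp: discrete_in_disk_def)
  then have inf: "infinite D" using countable_finite by blast
  have part1: "in_S \<kappa> D f" if k1: "k_num D f (2*\<kappa>) = \<kappa>" and k2: "k_num D f (2*\<kappa>+3) = \<kappa>"
  proof -
    obtain zs where zs: "length zs = 2*\<kappa>" "distinct zs" "set zs \<subseteq> D" "sq_minus (pick_matrix f zs) = \<kappa>"
      using k_num_attained[OF inf, of "2*\<kappa>" f] k1 by metis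
    then have "has_negative_squares ?K (set zs) \<kappa>" by (simp add: has_negative_squares_pick_iff)
    then obtain B where B: "B \<subseteq> set zs" "has_negative_squares ?K B \<kappa>" "nondegenerate_on ?K B"
      using has_negative_squares_nondegenerate_subset[OF _ hermitian_pick_kernel] by blast
    have finB: "finite B" "card B \<le> 2*\<kappa>"
      using B(1) zs(1,2) finite_subset card_mono[OF _ B(1)] distinct_card[OF zs(2)] by auto
    \<comment> \<open>At most 2 \<kappa> points of \<open>B\<close> and three more stay within 2
      \<kappa> + 3.\<close>
    have three: "\<not> has_negative_squares ?K (B \<union> A) (Suc \<kappa>)" if "finite A" "A \<subseteq> D" "card A \<le> 3" for A
    proof
      assume *: "has_negative_squares ?K (B \<union> A) (Suc \<kappa>)"
      have "card (B \<union> A) \<le> 2*\<kappa>+3" using card_Un_le[of B A] finB that by linarith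
      then have "Suc \<kappa> \<le> k_num D f (2*\<kappa>+3)"
        using that finB B(1) zs(3) by (intro has_negative_squares_le_k_num[OF inf _ _ _ *]) auto
      then show False using k2 by simp
    qed
    have all: "\<not> has_negative_squares ?K A (Suc \<kappa>)" if "finite A" "A \<subseteq> D" for A
      using pick_negative_squares_propagate[OF L finB(1) _ B(3,2)] three that B(1) zs(3)
      unfolding D_def by auto
    have "sq_minus (pick_matrix f us) \<le> \<kappa>" if "distinct us" "set us \<subseteq> D" for us
      using all[of "set us"] has_negative_squares_pick_iff[OF that(1)] that(2) by (simp add: not_less_eq_eq)
    then show ?thesis unfolding in_S_def using zs assms D by blast
  qed
  have part2: "k_num D f (2*\<kappa>) = \<kappa>" if S: "in_S \<kappa> D f"
  proof -
    have le: "sq_minus (pick_matrix f us) \<le> \<kappa>" if "distinct us" "set us \<subseteq> D" for us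
      using S that unfolding in_S_def by blast
    obtain zs where zs: "distinct zs" "set zs \<subseteq> D" "sq_minus (pick_matrix f zs) = \<kappa>"
      using S unfolding in_S_def by blast
    have all: "\<not> has_negative_squares ?K A (Suc \<kappa>)" if A: "finite A" "A \<subseteq> D" for A
    proof -
      obtain us where us: "set us = A" "distinct us" using finite_distinct_list[OF A(1)] by blast
      then show ?thesis using has_negative_squares_pick_iff[OF us(2), of f "Suc \<kappa>"] le[OF us(2)] A by auto
    qed
    have zsK: "has_negative_squares ?K (set zs) \<kappa>" using zs by (simp add: has_negative_squares_pick_iff)
    then obtain B where B: "B \<subseteq> set zs" "has_negative_squares ?K B \<kappa>" "nondegenerate_on ?K B"
      using has_negative_squares_nondegenerate_subset[OF _ hermitian_pick_kernel] by blast
    have finB: "finite B" using B(1) finite_subset by blast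
    have all': "\<not> has_negative_squares ?K (B \<union> A) (Suc \<kappa>)" if "finite A" "A \<subseteq> D" for A
      using all[of "B \<union> A"] that finB B(1) zs(2) by auto
    \<comment> \<open>No finite set exceeds \<kappa> negative squares here, so the first alternative
      of \<open>three\<close> is available for \<open>B\<close>.\<close>
    have hol: "\<exists>N. sparse_in_disk N \<and> f holomorphic_on ball 0 1 - N"
      using pick_negative_squares_propagate[OF L finB _ B(3,2)] all' B(1) zs(2) unfolding D_def by auto
    \<comment> \<open>Starting from the empty set, each further negative square costs at most two
      points.\<close>
    have "j \<le> \<kappa> \<Longrightarrow> \<exists>A\<subseteq>D. finite A \<and> card A \<le> 2*j \<and> has_negative_squares ?K A j" for j
    proof (induction j)
      case 0
      then show ?case by (intro exI[of _ "{}"]) simp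
    next
      case (Suc j)
      then obtain A where A: "A \<subseteq> D" "finite A" "card A \<le> 2*j" "has_negative_squares ?K A j" by auto
      \<comment> \<open>Propagation needs an invertible Pick matrix; passing to \<open>C\<close> can
        only lower the number of points.\<close>
      then obtain C where C: "C \<subseteq> A" "has_negative_squares ?K C j" "nondegenerate_on ?K C"
        using has_negative_squares_nondegenerate_subset[OF _ hermitian_pick_kernel] by blast
      have finC: "finite C" "card C \<le> 2*j"
        using C(1) A(2,3) finite_subset card_mono[OF A(2) C(1)] by auto
      \<comment> \<open>Otherwise propagation from \<open>C\<close> would bound every finite set by
        \<open>j\<close> negative squares, although \<open>zs\<close> has \<kappa> and
        \<open>j\<close> is smaller.\<close>
      have "\<exists>A'. finite A' \<and> A' \<subseteq> D \<and> card A' \<le> 2 \<and> has_negative_squares ?K (C \<union> A') (Suc j)"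
      proof (rule ccontr)
        assume "\<not> ?thesis"
        then have "\<not> has_negative_squares ?K (set zs) (Suc j)"
          using pick_negative_squares_propagate[OF L finC(1) _ C(3,2) _ disjI2[OF hol]] C(1) A(1) zs(2)
          unfolding D_def by auto
        then show False using has_negative_squares_le[OF zsK] Suc.prems by blast
      qed
      then obtain A' where A': "finite A'" "A' \<subseteq> D" "card A' \<le> 2" "has_negative_squares ?K (C \<union> A') (Suc j)" by blast
      then have "card (C \<union> A') \<le> 2 * Suc j" using card_Un_le[of C A'] finC by simp
      then show ?case using A' finC C(1) A(1) by (intro exI[of _ "C \<union> A'"]) auto
    qed
    then obtain A where "A \<subseteq> D" "finite A" "card A \<le> 2*\<kappa>" "has_negative_squares ?K A \<kappa>" by blast
    then have "\<kappa> \<le> k_num D f (2*\<kappa>)" using has_negative_squares_le_k_num[OF inf] by blast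
    moreover obtain us where "distinct us" "set us \<subseteq> D" "sq_minus (pick_matrix f us) = k_num D f (2*\<kappa>)"
      using k_num_attained[OF inf] by blast
    ultimately show ?thesis using le by (metis le_antisym)
  qed
  show ?thesis unfolding D using part1 part2 by blast
qed

end
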